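(* Let $L$ be a frame. The biframe homomorphism $h:\mathbb{C}_{\aleph_0}L\to\mathbb{C}L$ given by $h(C)=\langle C\rangle_{\mathbf{Frm}}$, the frame congruence on $L$ generated by the lattice congruence $C$, is the universal biframe compactification of $\mathbb{C}L$.
   Context: A biframe is a triple $M=(M_0,M_1,M_2)$ where $M_0$ is a frame and $M_1,M_2$ are subframes whose union generates $M_0$; a biframe homomorphism $M\to N$ is a frame homomorphism $M_0\to N_0$ mapping $M_i$ into $N_i$ for $i=1,2$. It is dense if only $0$ is sent to $0$ on total parts and surjective if its restrictions to first and second parts are surjective. $M$ is compact if $M_0$ is. For $x,y\in M_i$ write $x\prec_i y$ if there is $z\in M_k$ ($\{i,k\}=\{1,2\}$) with $x\wedge z=0$ and $y\vee z=1$; $M$ is regular if, for $i=1,2$, each element of $M_i$ is a join of elements $\prec_i$-below it. A biframe compactification of $M$ is a dense surjective biframe homomorphism from a compact regular biframe to $M$; it is the universal one if every biframe homomorphism from a compact regular biframe to $M$ factors uniquely through it (it is the compact regular coreflection). $\mathbb{C}L$ is the frame of frame congruences on $L$ (equivalence relations closed under finite meets and arbitrary joins in $L\times L$) ordered by inclusion; $\mathbb{C}_{\aleph_0}L$ is the frame of bounded-lattice congruences on $L$ (equivalence relations closed under finite meets and finite joins) ordered by inclusion. For $a\in L$, $\nabla_a$ and $\Delta_a$ denote the congruences generated by $(0,a)$ and $(a,1)$ respectively (explicitly $\nabla_a=\{(x,y)\mid x\vee a=y\vee a\}$ and $\Delta_a=\{(x,y)\mid x\wedge a=y\wedge a\}$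 in both cases). Both frames are viewed as biframes whose first part is the subframe generated by all $\nabla_a$ and whose second part is the subframe generated by all $\Delta_a$, $a\in L$. *)

theory Defs
  imports "HOL-Algebra.Complete_Lattice" "HOL-Library.FuncSet"
begin

section \<open>Frames\<close>

locale frame = complete_lattice +
  assumes meet_sup_distrib:
    "\<lbrakk>x \<in> carrier L; A \<subseteq> carrier L\<rbrakk> \<Longrightarrow> x \<sqinter> (\<Squnion>A) = \<Squnion>((\<lambda>a. x \<sqinter> a) ` A)"

text \<open>The library's predicate \<open>sup_pres\<close> ranges over all subsets of the carrier, including the
  empty one, so that frame homomorphisms preserve the bottom element.\<close>

definition frame_hom ::
  "('a, 'm) gorder_scheme \<Rightarrow> ('b, 'n) gorder_scheme \<Rightarrow> ('a \<Rightarrow> 'b) \<Rightarrow> bool" where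
  "frame_hom L M f \<longleftrightarrow>
     frame L \<and> frame M \<and> f \<in> carrier L \<rightarrow> carrier M \<and>
     f \<top>\<^bsub>L\<^esub> = \<top>\<^bsub>M\<^esub> \<and> meet_pres L M f \<and> sup_pres L M f"

definition compact_frame :: "('a, 'm) gorder_scheme \<Rightarrow> bool" where
  "compact_frame L \<longleftrightarrow>
     frame L \<and>
     (\<forall>A \<subseteq> carrier L. \<Squnion>\<^bsub>L\<^esub>A = \<top>\<^bsub>L\<^esub> \<longrightarrow> (\<exists>F \<subseteq> A. finite F \<and> \<Squnion>\<^bsub>L\<^esub>F = \<top>\<^bsub>L\<^esub>))"

definition subframe :: "'a set \<Rightarrow> ('a, 'm) gorder_scheme \<Rightarrow> bool" where
  "subframe S L \<longleftrightarrow>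
     S \<subseteq> carrier L \<and> \<top>\<^bsub>L\<^esub> \<in> S \<and>
     (\<forall>x\<in>S. \<forall>y\<in>S. x \<sqinter>\<^bsub>L\<^esub> y \<in> S) \<and>
     (\<forall>A \<subseteq> S. \<Squnion>\<^bsub>L\<^esub>A \<in> S)"

definition subframe_generated :: "('a, 'm) gorder_scheme \<Rightarrow> 'a set \<Rightarrow> 'a set" where
  "subframe_generated L X = \<Inter>{S. subframe S L \<and> X \<subseteq> S}"


section \<open>Biframes\<close>

text \<open>A biframe record extends the order structure of its total part by the two subframes.\<close>

record 'a biframe = "'a gorder" +
  part1 :: "'a set"
  part2 :: "'a set"

definition biframe :: "('a, 'm) biframe_scheme \<Rightarrow> bool" where
  "biframe M \<longleftrightarrow>
     frame M \<and> subframe (part1 M) M \<and> subframe (part2 M) M \<and>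
     subframe_generated M (part1 M \<union> part2 M) = carrier M"

definition biframe_hom ::
  "('a, 'm) biframe_scheme \<Rightarrow> ('b, 'n) biframe_scheme \<Rightarrow> ('a \<Rightarrow> 'b) \<Rightarrow> bool" where
  "biframe_hom M N f \<longleftrightarrow>
     biframe M \<and> biframe N \<and> frame_hom M N f \<and>
     f ` part1 M \<subseteq> part1 N \<and> f ` part2 M \<subseteq> part2 N"

definition dense_biframe_hom ::
  "('a, 'm) biframe_scheme \<Rightarrow> ('b, 'n) biframe_scheme \<Rightarrow> ('a \<Rightarrow> 'b) \<Rightarrow> bool" where
  "dense_biframe_hom M N f \<longleftrightarrow>
     biframe_hom M N f \<and> (\<forall>x\<in>carrier M. f x = \<bottom>\<^bsub>N\<^esub> \<longrightarrow> x = \<bottom>\<^bsub>M\<^esub>)"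

definition surjective_biframe_hom ::
  "('a, 'm) biframe_scheme \<Rightarrow> ('b, 'n) biframe_scheme \<Rightarrow> ('a \<Rightarrow> 'b) \<Rightarrow> bool" where
  "surjective_biframe_hom M N f \<longleftrightarrow>
     biframe_hom M N f \<and> f ` part1 M = part1 N \<and> f ` part2 M = part2 N"

definition compact_biframe :: "('a, 'm) biframe_scheme \<Rightarrow> bool" where
  "compact_biframe M \<longleftrightarrow> biframe M \<and> compact_frame M"

text \<open>The set \<open>P\<close> is the part from which the witness is taken: for elements of one part of
  a biframe, the relation \<open>\<prec>\<^sub>i\<close> is \<open>rather_below\<close> with \<open>P\<close> the \<^emph>\<open>opposite\<close> part.\<close>

definition rather_below :: "('a, 'm) gorder_scheme \<Rightarrow> 'a set \<Rightarrow> 'a \<Rightarrow> 'a \<Rightarrow> bool" where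
  "rather_below M P x y \<longleftrightarrow> (\<exists>z\<in>P. x \<sqinter>\<^bsub>M\<^esub> z = \<bottom>\<^bsub>M\<^esub> \<and> y \<squnion>\<^bsub>M\<^esub> z = \<top>\<^bsub>M\<^esub>)"

definition regular_biframe :: "('a, 'm) biframe_scheme \<Rightarrow> bool" where
  "regular_biframe M \<longleftrightarrow>
     biframe M \<and>
     (\<forall>y\<in>part1 M. \<exists>A \<subseteq> {x \<in> part1 M. rather_below M (part2 M) x y}. y = \<Squnion>\<^bsub>M\<^esub>A) \<and>
     (\<forall>y\<in>part2 M. \<exists>A \<subseteq> {x \<in> part2 M. rather_below M (part1 M) x y}. y = \<Squnion>\<^bsub>M\<^esub>A)"

definition biframe_compactification ::
  "('a, 'm) biframe_scheme \<Rightarrow> ('b, 'n) biframe_scheme \<Rightarrow> ('a \<Rightarrow> 'b) \<Rightarrow> bool" where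
  "biframe_compactification K M h \<longleftrightarrow>
     compact_biframe K \<and> regular_biframe K \<and>
     dense_biframe_hom K M h \<and> surjective_biframe_hom K M h"

text \<open>A definition cannot quantify over the carrier type of the test biframe \<open>N\<close>, which is
  therefore a parameter; a theorem in which \<^typ>\<open>'c\<close> is a free type variable
  asserts the universal property for test biframes over every type. Homomorphisms are only
  determined on carriers, hence the restriction to extensional functions.\<close>

definition universal_biframe_compactification ::
  "'c itself \<Rightarrow> ('a, 'm) biframe_scheme \<Rightarrow> ('b, 'n) biframe_scheme \<Rightarrow> ('a \<Rightarrow> 'b) \<Rightarrow> bool" where
  "universal_biframe_compactification (_ :: 'c itself) K M h \<longleftrightarrow>
     biframe_compactification K M h \<and>
     (\<forall>(N :: 'c biframe) f.
        compact_biframe N \<and> regular_biframe N \<and> biframe_hom N M f \<longrightarrow>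
        (\<exists>!g. g \<in> extensional (carrier N) \<and> biframe_hom N K g \<and>
              (\<forall>x\<in>carrier N. h (g x) = f x)))"


section \<open>Congruences\<close>

text \<open>Finite meets are the top element and binary meets; closure under the empty meet (and, for
  lattice congruences, the empty join) is part of reflexivity. Meets and joins in \<open>L \<times> L\<close> are
  componentwise.\<close>

definition lattice_congruence :: "('a, 'm) gorder_scheme \<Rightarrow> ('a \<times> 'a) set \<Rightarrow> bool" where
  "lattice_congruence L \<theta> \<longleftrightarrow>
     equiv (carrier L) \<theta> \<and>
     (\<forall>(x, y)\<in>\<theta>. \<forall>(x', y')\<in>\<theta>. (x \<sqinter>\<^bsub>L\<^esub> x', y \<sqinter>\<^bsub>L\<^esub> y') \<in> \<theta>) \<and>
     (\<forall>(x, y)\<in>\<theta>. \<forall>(x', y')\<in>\<theta>. (x \<squnion>\<^bsub>L\<^esub> x', y \<squnion>\<^bsub>L\<^esub> y') \<in> \<theta>)"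

definition frame_congruence :: "('a, 'm) gorder_scheme \<Rightarrow> ('a \<times> 'a) set \<Rightarrow> bool" where
  "frame_congruence L \<theta> \<longleftrightarrow>
     equiv (carrier L) \<theta> \<and>
     (\<forall>(x, y)\<in>\<theta>. \<forall>(x', y')\<in>\<theta>. (x \<sqinter>\<^bsub>L\<^esub> x', y \<sqinter>\<^bsub>L\<^esub> y') \<in> \<theta>) \<and>
     (\<forall>R \<subseteq> \<theta>. (\<Squnion>\<^bsub>L\<^esub>(fst ` R), \<Squnion>\<^bsub>L\<^esub>(snd ` R)) \<in> \<theta>)"

definition lattice_congruence_generated ::
  "('a, 'm) gorder_scheme \<Rightarrow> ('a \<times> 'a) set \<Rightarrow> ('a \<times> 'a) set" where
  "lattice_congruence_generated L R = \<Inter>{\<theta>. lattice_congruence L \<theta> \<and> R \<subseteq> \<theta>}"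

definition frame_congruence_generated ::
  "('a, 'm) gorder_scheme \<Rightarrow> ('a \<times> 'a) set \<Rightarrow> ('a \<times> 'a) set" where
  "frame_congruence_generated L R = \<Inter>{\<theta>. frame_congruence L \<theta> \<and> R \<subseteq> \<theta>}"

definition inclusion_order :: "'b set set \<Rightarrow> 'b set gorder" where
  "inclusion_order \<C> = \<lparr>carrier = \<C>, eq = (=), le = (\<subseteq>)\<rparr>"

text \<open>The biframe on a set \<open>\<C>\<close> of congruences on \<open>L\<close>, where \<open>gen\<close> sends a relation to the
  congruence in \<open>\<C>\<close> that it generates: the first part is generated by the \<open>\<nabla>\<^sub>a\<close> and the
  second by the \<open>\<Delta>\<^sub>a\<close>.\<close>

definition congruence_biframe ::
  "('a, 'm) gorder_scheme \<Rightarrow> ('a \<times> 'a) set set \<Rightarrow> (('a \<times> 'a) set \<Rightarrow> ('a \<times> 'a) set)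
     \<Rightarrow> ('a \<times> 'a) set biframe" where
  "congruence_biframe L \<C> gen =
     \<lparr>carrier = \<C>, eq = (=), le = (\<subseteq>),
      part1 = subframe_generated (inclusion_order \<C>) ((\<lambda>a. gen {(\<bottom>\<^bsub>L\<^esub>, a)}) ` carrier L),
      part2 = subframe_generated (inclusion_order \<C>) ((\<lambda>a. gen {(a, \<top>\<^bsub>L\<^esub>)}) ` carrier L)\<rparr>"

definition lattice_congruence_biframe ::
  "('a, 'm) gorder_scheme \<Rightarrow> ('a \<times> 'a) set biframe" where
  "lattice_congruence_biframe L =
     congruence_biframe L {\<theta>. lattice_congruence L \<theta>} (lattice_congruence_generated L)"

definition frame_congruence_biframe ::
  "('a, 'm) gorder_scheme \<Rightarrow> ('a \<times> 'a) set biframe" where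
  "frame_congruence_biframe L =
     congruence_biframe L {\<theta>. frame_congruence L \<theta>} (frame_congruence_generated L)"

end

theory Submission
  imports Defs
begin

text \<open>The points of the frame of lattice congruences on \<open>L\<close> are the prime filters \<open>P\<close> of \<open>L\<close>: a
  congruence is the intersection of the kernels of the prime filters that respect it
  (\<open>lattice_congruence_separation\<close>). The universal property of \<open>h\<close> is therefore a statement about these
  points. Let \<open>f\<close> map a compact regular biframe \<open>N\<close> to the frame congruences. The first part of
  the target is \<open>{\<nabla>\<^sub>a | a \<in> L}\<close>, a copy of \<open>L\<close>, so on the first part of \<open>N\<close> the map \<open>f\<close> is a
  frame homomorphism \<open>u\<close> into \<open>L\<close>. For a prime filter \<open>P\<close>, let \<open>q\<close> be the join of the \<open>w\<close> in the
  first part with \<open>u w \<notin> P\<close> and of the \<open>y\<close> in the second part that are disjoint from some \<open>t\<close> with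
  \<open>u t \<in> P\<close>. Compactness gives \<open>q \<noteq> 1\<close>, and regularity shows that every \<open>n\<close> not below \<open>q\<close> satisfies
  \<open>n \<squnion> q = 1\<close>; hence \<open>q\<close> is prime, a point of \<open>N\<close> (\<open>point_proper\<close>, \<open>meet_le_point_iff\<close>). The lift \<open>g\<close> is the frame map dual to
  \<open>P \<mapsto> q\<close>: \<open>g n\<close> is the set of the pairs that no \<open>P\<close> with \<open>n \<le> q\<close> separates. It preserves finite
  meets because every \<open>q\<close> is prime, and joins because kernels of prime filters separate pairs from
  congruences. On the two parts of \<open>N\<close> it has the explicit form
  \<open>g x = \<Squnion>{\<nabla>\<^bsub>u w\<^esub> | w \<prec> x}\<close> and \<open>g y = \<Squnion>{\<Delta>\<^bsub>u t\<^esub> | t \<squnion> y = 1}\<close>, from which \<open>h \<circ> g = f\<close> can be read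
  off. Uniqueness of \<open>g\<close> is the fact that a dense homomorphism can be cancelled in front of a regular
  domain (\<open>dense_biframe_hom_cancel\<close>).

  That both sets of congruences are frames, and that \<open>h\<close> preserves meets, follows from one formula.
  For \<open>c \<le> d\<close> the map \<open>x \<mapsto> (x \<sqinter> d) \<squnion> c\<close> preserves binary meets and nonempty joins, so congruences of
  either kind can be pulled back along it, and the intersection of the pullbacks of \<open>D\<close> over all pairs
  \<open>c \<le> d\<close> of \<open>C\<close> is the implication \<open>C \<rightarrow> D\<close>. It is a frame congruence as soon as \<open>D\<close> is one, for
  every lattice congruence \<open>C\<close> (\<open>inter_gen_subset\<close>, \<open>frame_congruence_generated_inter\<close>).
  Regularity holds because \<open>\<nabla>\<^sub>a\<close> and \<open>\<Delta>\<^sub>a\<close> are complements, compactness because lattice congruences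
  are generated by finitary operations.\<close>

section \<open>Frames\<close>

context frame
begin

lemma sup_empty: "\<Squnion>{} = \<bottom>"
  using weak_sup_empty eq_is_equal by simp

lemma top_le_iff: "x \<in> carrier L \<Longrightarrow> \<top> \<sqsubseteq> x \<longleftrightarrow> x = \<top>"
  by (metis le_antisym le_refl top_closed top_higher)

lemma meet_absorb1: "x \<in> carrier L \<Longrightarrow> y \<in> carrier L \<Longrightarrow> x \<sqsubseteq> y \<Longrightarrow> x \<sqinter> y = x"
  using le_iff_join by metis

lemma meet_absorb2: "x \<in> carrier L \<Longrightarrow> y \<in> carrier L \<Longrightarrow> x \<sqsubseteq> y \<Longrightarrow> y \<sqinter> x = x"
  using meet_absorb1 meet_comm by metis

lemma join_absorb1: "x \<in> carrier L \<Longrightarrow> y \<in> carrier L \<Longrightarrow> x \<sqsubseteq> y \<Longrightarrow> x \<squnion> y = y"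
  using le_iff_meet by metis

lemma join_absorb2: "x \<in> carrier L \<Longrightarrow> y \<in> carrier L \<Longrightarrow> x \<sqsubseteq> y \<Longrightarrow> y \<squnion> x = y"
  using join_absorb1 join_comm by metis

lemma lattice_bounds [simp]:
  assumes "x \<in> carrier L"
  shows "x \<sqinter> x = x" "x \<squnion> x = x" "x \<sqinter> \<top> = x" "\<top> \<sqinter> x = x" "x \<squnion> \<top> = \<top>" "\<top> \<squnion> x = \<top>"
    "x \<sqinter> \<bottom> = \<bottom>" "\<bottom> \<sqinter> x = \<bottom>" "x \<squnion> \<bottom> = x" "\<bottom> \<squnion> x = x"
  using assms by (simp_all add: meet_absorb1 meet_absorb2 join_absorb1 join_absorb2)

lemma meet_mono:
  assumes "x \<in> carrier L" "y \<in> carrier L" "x' \<in> carrier L" "y' \<in> carrier L"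
    and "x \<sqsubseteq> x'" "y \<sqsubseteq> y'"
  shows "x \<sqinter> y \<sqsubseteq> x' \<sqinter> y'"
proof (rule meet_le)
  show "x \<sqinter> y \<sqsubseteq> x'" by (rule le_trans[OF meet_left assms(5)]) (use assms in simp_all)
  show "x \<sqinter> y \<sqsubseteq> y'" by (rule le_trans[OF meet_right assms(6)]) (use assms in simp_all)
qed (use assms in simp_all)

lemma meet_join_distrib:
  assumes "x \<in> carrier L" "y \<in> carrier L" "z \<in> carrier L"
  shows "x \<sqinter> (y \<squnion> z) = (x \<sqinter> y) \<squnion> (x \<sqinter> z)"
  using meet_sup_distrib[of x "{y, z}"] assms by (simp add: join_def)

lemma meet_join_distrib2:
  assumes "x \<in> carrier L" "y \<in> carrier L" "z \<in> carrier L"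
  shows "(y \<squnion> z) \<sqinter> x = (y \<sqinter> x) \<squnion> (z \<sqinter> x)"
  using meet_join_distrib assms meet_comm by metis

lemma join_left_comm:
  assumes "x \<in> carrier L" "y \<in> carrier L" "z \<in> carrier L"
  shows "x \<squnion> (y \<squnion> z) = y \<squnion> (x \<squnion> z)"
  using assms join_assoc join_comm by metis

lemma meet_left_comm:
  assumes "x \<in> carrier L" "y \<in> carrier L" "z \<in> carrier L"
  shows "x \<sqinter> (y \<sqinter> z) = y \<sqinter> (x \<sqinter> z)"
  using assms meet_assoc meet_comm by metis

lemma join_meet_distrib:
  assumes "x \<in> carrier L" "y \<in> carrier L" "z \<in> carrier L"
  shows "x \<squnion> (y \<sqinter> z) = (x \<squnion> y) \<sqinter> (x \<squnion> z)"
proof -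
  have "(x \<squnion> y) \<sqinter> (x \<squnion> z) = ((x \<squnion> y) \<sqinter> x) \<squnion> ((x \<squnion> y) \<sqinter> z)"
    using assms by (intro meet_join_distrib) auto
  also have "(x \<squnion> y) \<sqinter> x = x"
    using assms by (intro meet_absorb2 join_left) auto
  also have "(x \<squnion> y) \<sqinter> z = (x \<sqinter> z) \<squnion> (y \<sqinter> z)"
    using assms by (intro meet_join_distrib2) auto
  also have "x \<squnion> ((x \<sqinter> z) \<squnion> (y \<sqinter> z)) = (x \<squnion> (x \<sqinter> z)) \<squnion> (y \<sqinter> z)"
    using assms by (intro join_assoc[symmetric]) auto
  also have "x \<squnion> (x \<sqinter> z) = x"
    using assms by (intro join_absorb2 meet_left) auto
  finally show ?thesis by simp
qed

lemma cover_le: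
  assumes "x \<in> carrier L" "y \<in> carrier L" "z \<in> carrier L" "x \<sqinter> z = \<bottom>" "y \<squnion> z = \<top>"
  shows "x \<sqsubseteq> y"
proof -
  have "x = x \<sqinter> (y \<squnion> z)" using assms by simp
  also have "\<dots> = (x \<sqinter> y) \<squnion> (x \<sqinter> z)" using assms(1-3) by (rule meet_join_distrib)
  also have "\<dots> = x \<sqinter> y" using assms by simp
  finally show ?thesis using assms le_iff_join by blast
qed

lemma sup_mono:
  assumes "A \<subseteq> carrier L" "B \<subseteq> carrier L" "\<And>x. x \<in> A \<Longrightarrow> \<exists>y\<in>B. x \<sqsubseteq> y"
  shows "\<Squnion>A \<sqsubseteq> \<Squnion>B"
proof (rule sup_least)
  fix x assume "x \<in> A"
  then obtain y where y: "y \<in> B" "x \<sqsubseteq> y" using assms(3) by blast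
  then have "y \<sqsubseteq> \<Squnion>B" using sup_upper assms by blast
  then show "x \<sqsubseteq> \<Squnion>B"
    using y \<open>x \<in> A\<close> assms by (meson le_trans subsetD sup_closed)
qed (use assms in auto)

lemma subframe_generated_least: "subframe S L \<Longrightarrow> X \<subseteq> S \<Longrightarrow> subframe_generated L X \<subseteq> S"
  unfolding subframe_generated_def by blast

lemma subset_subframe_generated: "X \<subseteq> subframe_generated L X"
  unfolding subframe_generated_def by blast

lemma subframe_carrier: "subframe (carrier L) L"
  unfolding subframe_def by auto

lemma subframe_subframe_generated:
  assumes "X \<subseteq> carrier L" shows "subframe (subframe_generated L X) L"
proof -
  have "subframe_generated L X \<subseteq> carrier L"
    using subframe_generated_least[OF subframe_carrier assms] .
  then show ?thesis
    unfolding subframe_def[of "subframe_generated L X"]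
    by (simp add: subframe_generated_def subset_iff) (simp add: subframe_def subset_iff)
qed

lemma sup_meet_sup:
  assumes A: "A \<subseteq> carrier L" and B: "B \<subseteq> carrier L"
  shows "\<Squnion>A \<sqinter> \<Squnion>B = \<Squnion>{a \<sqinter> b |a b. a \<in> A \<and> b \<in> B}" (is "_ = \<Squnion>?C")
proof (rule le_antisym)
  have C: "?C \<subseteq> carrier L" using A B by (auto intro: meet_closed)
  have "a \<sqinter> \<Squnion>B \<sqsubseteq> \<Squnion>?C" if "a \<in> A" for a
  proof -
    have a: "a \<in> carrier L" using that A by auto
    have "\<Squnion>((\<lambda>b. a \<sqinter> b) ` B) \<sqsubseteq> \<Squnion>?C"
      by (rule sup_mono) (use that a B C in \<open>blast intro: le_refl\<close>)+
    then show ?thesis using meet_sup_distrib a B by simp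
  qed
  then have le: "\<Squnion>B \<sqinter> a \<sqsubseteq> \<Squnion>?C" if "a \<in> A" for a
    using that meet_comm[of L "\<Squnion>B" a] by simp
  have "\<Squnion>((\<lambda>a. \<Squnion>B \<sqinter> a) ` A) \<sqsubseteq> \<Squnion>?C"
    by (rule sup_least) (use A B C le in \<open>auto intro!: meet_closed sup_closed\<close>)
  then show "\<Squnion>A \<sqinter> \<Squnion>B \<sqsubseteq> \<Squnion>?C"
    using meet_sup_distrib[of "\<Squnion>B" A] A B meet_comm[of L "\<Squnion>A" "\<Squnion>B"] by simp
  show "\<Squnion>?C \<sqsubseteq> \<Squnion>A \<sqinter> \<Squnion>B"
  proof (rule sup_least)
    fix c assume "c \<in> ?C"
    then obtain a b where "c = a \<sqinter> b" "a \<in> A" "b \<in> B" by blast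
    then show "c \<sqsubseteq> \<Squnion>A \<sqinter> \<Squnion>B"
      using A B by (auto intro!: meet_mono sup_upper)
  qed (use A B C in \<open>auto intro!: meet_closed sup_closed\<close>)
qed (use A B in \<open>auto intro!: meet_closed sup_closed\<close>)

text \<open>Frame distributivity makes a base closed under finite meets generate a subframe by joins
  alone.\<close>

lemma subframe_generated_base:
  assumes B: "B \<subseteq> carrier L" and top: "\<top> \<in> B"
    and meet: "\<And>a b. a \<in> B \<Longrightarrow> b \<in> B \<Longrightarrow> a \<sqinter> b \<in> B"
  shows "subframe_generated L B = {\<Squnion>A |A. A \<subseteq> B}" (is "_ = ?J")
proof
  show "subframe_generated L B \<subseteq> ?J"
  proof (rule subframe_generated_least)
    show "B \<subseteq> ?J"
    proof
      fix b assume "b \<in> B"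
      then have "b = \<Squnion>{b}" "{b} \<subseteq> B" using B by auto
      then show "b \<in> ?J" by blast
    qed
    show "subframe ?J L"
      unfolding subframe_def
    proof (intro conjI ballI allI impI)
      show "?J \<subseteq> carrier L" using B by auto
      show "\<top> \<in> ?J" using \<open>B \<subseteq> ?J\<close> top by blast
    next
      fix x y assume "x \<in> ?J" "y \<in> ?J"
      then obtain A A' where A: "x = \<Squnion>A" "A \<subseteq> B" "y = \<Squnion>A'" "A' \<subseteq> B" by blast
      then have "x \<sqinter> y = \<Squnion>{a \<sqinter> b |a b. a \<in> A \<and> b \<in> A'}" using B by (auto intro!: sup_meet_sup)
      moreover have "{a \<sqinter> b |a b. a \<in> A \<and> b \<in> A'} \<subseteq> B" using A meet by auto
      ultimately show "x \<sqinter> y \<in> ?J" by blast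
    next
      fix T assume T: "T \<subseteq> ?J"
      define U where "U = {b \<in> B. \<exists>t\<in>T. b \<sqsubseteq> t}"
      have Tc: "T \<subseteq> carrier L" using T B by auto
      have Uc: "U \<subseteq> carrier L" using B U_def by auto
      have "\<Squnion>T = \<Squnion>U"
      proof (rule le_antisym)
        show "\<Squnion>U \<sqsubseteq> \<Squnion>T" by (rule sup_mono) (use Tc Uc U_def in auto)
        show "\<Squnion>T \<sqsubseteq> \<Squnion>U"
        proof (rule sup_least)
          fix t assume t: "t \<in> T"
          then obtain A where A: "t = \<Squnion>A" "A \<subseteq> B" using T by blast
          have "A \<subseteq> U"
            using A B t sup_upper[of A] unfolding U_def by blast
          then show "t \<sqsubseteq> \<Squnion>U"
            unfolding A(1) using Uc by (intro sup_mono) blast+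
        qed (use Tc Uc in auto)
      qed (use Tc Uc in auto)
      then show "\<Squnion>T \<in> ?J" using U_def by blast
    qed
  qed
  show "?J \<subseteq> subframe_generated L B"
    using subset_subframe_generated[of B] subframe_subframe_generated[OF B]
    unfolding subframe_def by blast
qed

end

section \<open>Congruences\<close>

lemma
  assumes "lattice_congruence L \<theta>"
  shows congruence_closed: "\<theta> \<subseteq> carrier L \<times> carrier L"
    and congruence_refl: "x \<in> carrier L \<Longrightarrow> (x, x) \<in> \<theta>"
    and congruence_sym: "(x, y) \<in> \<theta> \<Longrightarrow> (y, x) \<in> \<theta>"
    and congruence_trans: "(x, y) \<in> \<theta> \<Longrightarrow> (y, z) \<in> \<theta> \<Longrightarrow> (x, z) \<in> \<theta>"
    and congruence_meet:
      "(x, y) \<in> \<theta> \<Longrightarrow> (x', y') \<in> \<theta> \<Longrightarrow> (x \<sqinter>\<^bsub>L\<^esub> x', y \<sqinter>\<^bsub>L\<^esub> y') \<in> \<theta>"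
    and congruence_join:
      "(x, y) \<in> \<theta> \<Longrightarrow> (x', y') \<in> \<theta> \<Longrightarrow> (x \<squnion>\<^bsub>L\<^esub> x', y \<squnion>\<^bsub>L\<^esub> y') \<in> \<theta>"
proof -
  note c = assms[unfolded lattice_congruence_def]
  have e: "equiv (carrier L) \<theta>" using c by blast
  show "\<theta> \<subseteq> carrier L \<times> carrier L" using e by (rule equiv_type)
  show "x \<in> carrier L \<Longrightarrow> (x, x) \<in> \<theta>" using e by (auto simp: equiv_def refl_on_def)
  show "(x, y) \<in> \<theta> \<Longrightarrow> (y, x) \<in> \<theta>" using e by (auto simp: equiv_def dest: symD)
  show "(x, y) \<in> \<theta> \<Longrightarrow> (y, z) \<in> \<theta> \<Longrightarrow> (x, z) \<in> \<theta>" using e by (auto simp: equiv_def dest: transD)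
  show "(x, y) \<in> \<theta> \<Longrightarrow> (x', y') \<in> \<theta> \<Longrightarrow> (x \<sqinter>\<^bsub>L\<^esub> x', y \<sqinter>\<^bsub>L\<^esub> y') \<in> \<theta>" using c by fast
  show "(x, y) \<in> \<theta> \<Longrightarrow> (x', y') \<in> \<theta> \<Longrightarrow> (x \<squnion>\<^bsub>L\<^esub> x', y \<squnion>\<^bsub>L\<^esub> y') \<in> \<theta>" using c by fast
qed

lemma lattice_congruenceI:
  assumes "\<theta> \<subseteq> carrier L \<times> carrier L" "\<And>x. x \<in> carrier L \<Longrightarrow> (x, x) \<in> \<theta>"
    and "\<And>x y. (x, y) \<in> \<theta> \<Longrightarrow> (y, x) \<in> \<theta>"
    and "\<And>x y z. (x, y) \<in> \<theta> \<Longrightarrow> (y, z) \<in> \<theta> \<Longrightarrow> (x, z) \<in> \<theta>"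
    and "\<And>x y x' y'. (x, y) \<in> \<theta> \<Longrightarrow> (x', y') \<in> \<theta> \<Longrightarrow> (x \<sqinter>\<^bsub>L\<^esub> x', y \<sqinter>\<^bsub>L\<^esub> y') \<in> \<theta>"
    and "\<And>x y x' y'. (x, y) \<in> \<theta> \<Longrightarrow> (x', y') \<in> \<theta> \<Longrightarrow> (x \<squnion>\<^bsub>L\<^esub> x', y \<squnion>\<^bsub>L\<^esub> y') \<in> \<theta>"
  shows "lattice_congruence L \<theta>"
proof -
  have "equiv (carrier L) \<theta>"
    by (rule equivI[OF assms(1)]; intro refl_onI symI transI; fact assms)
  then show ?thesis unfolding lattice_congruence_def using assms(5,6) by fast
qed

text \<open>The retraction of a distributive lattice onto the interval from \<open>c\<close> to \<open>d\<close>, if \<open>c \<le> d\<close>.\<close>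

definition squeeze :: "('a, 'm) gorder_scheme \<Rightarrow> 'a \<Rightarrow> 'a \<Rightarrow> 'a \<Rightarrow> 'a" where
  "squeeze L c d x = (x \<sqinter>\<^bsub>L\<^esub> d) \<squnion>\<^bsub>L\<^esub> c"

definition nabla :: "('a, 'm) gorder_scheme \<Rightarrow> 'a \<Rightarrow> ('a \<times> 'a) set" where
  "nabla L a = {(x, y) \<in> carrier L \<times> carrier L. x \<squnion>\<^bsub>L\<^esub> a = y \<squnion>\<^bsub>L\<^esub> a}"

definition delta :: "('a, 'm) gorder_scheme \<Rightarrow> 'a \<Rightarrow> ('a \<times> 'a) set" where
  "delta L a = {(x, y) \<in> carrier L \<times> carrier L. x \<sqinter>\<^bsub>L\<^esub> a = y \<sqinter>\<^bsub>L\<^esub> a}"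

text \<open>The Heyting implication between congruences, in a form that inherits from \<open>D\<close> closure under
  arbitrary joins.\<close>

definition congruence_imp ::
  "('a, 'm) gorder_scheme \<Rightarrow> ('a \<times> 'a) set \<Rightarrow> ('a \<times> 'a) set \<Rightarrow> ('a \<times> 'a) set" where
  "congruence_imp L C D =
     {(x, y) \<in> carrier L \<times> carrier L.
        \<forall>(c, d)\<in>C. c \<sqsubseteq>\<^bsub>L\<^esub> d \<longrightarrow> (squeeze L c d x, squeeze L c d y) \<in> D}"

context frame
begin

lemma squeeze_closed [simp]:
  "x \<in> carrier L \<Longrightarrow> c \<in> carrier L \<Longrightarrow> d \<in> carrier L \<Longrightarrow> squeeze L c d x \<in> carrier L"
  by (simp add: squeeze_def)

lemma squeeze_meet:
  assumes "x \<in> carrier L" "y \<in> carrier L" "c \<in> carrier L" "d \<in> carrier L"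
  shows "squeeze L c d (x \<sqinter> y) = squeeze L c d x \<sqinter> squeeze L c d y"
proof -
  have "(x \<sqinter> d) \<sqinter> (y \<sqinter> d) = x \<sqinter> (d \<sqinter> (y \<sqinter> d))"
    using assms by (intro meet_assoc) auto
  also have "d \<sqinter> (y \<sqinter> d) = y \<sqinter> d"
    using assms by (intro meet_absorb2 meet_right) auto
  also have "x \<sqinter> (y \<sqinter> d) = (x \<sqinter> y) \<sqinter> d"
    using assms by (intro meet_assoc[symmetric]) auto
  finally have *: "(x \<sqinter> y) \<sqinter> d = (x \<sqinter> d) \<sqinter> (y \<sqinter> d)" by simp
  show ?thesis
    unfolding squeeze_def * join_comm[of L _ c] using assms by (intro join_meet_distrib) auto
qed

lemma squeeze_sup:
  assumes A: "A \<subseteq> carrier L" "A \<noteq> {}" and c: "c \<in> carrier L" and d: "d \<in> carrier L"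
  shows "squeeze L c d (\<Squnion>A) = \<Squnion>(squeeze L c d ` A)"
proof -
  have cl: "squeeze L c d ` A \<subseteq> carrier L" using A c d by auto
  have A': "a \<in> carrier L" if "a \<in> A" for a using that A by auto
  have sA: "\<Squnion>A \<in> carrier L" using A by simp
  have sS: "\<Squnion>(squeeze L c d ` A) \<in> carrier L" using cl by simp
  have up: "squeeze L c d a \<sqsubseteq> \<Squnion>(squeeze L c d ` A)" if "a \<in> A" for a
    using that cl by (intro sup_upper) auto
  show ?thesis
  proof (rule le_antisym)
    have "d \<sqinter> a \<sqsubseteq> \<Squnion>(squeeze L c d ` A)" if a: "a \<in> A" for a
    proof (rule le_trans[OF _ up[OF a]])
      show "d \<sqinter> a \<sqsubseteq> squeeze L c d a"
        unfolding squeeze_def meet_comm[of L d a] using A'[OF a] c d by (intro join_left) auto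
    qed (use A'[OF a] c d sS in auto)
    then have "\<Squnion>((\<lambda>a. d \<sqinter> a) ` A) \<sqsubseteq> \<Squnion>(squeeze L c d ` A)"
      using A' d sS by (intro sup_least) auto
    then have 1: "\<Squnion>A \<sqinter> d \<sqsubseteq> \<Squnion>(squeeze L c d ` A)"
      using A d meet_sup_distrib[of d A] meet_comm[of L d "\<Squnion>A"] by simp
    obtain a where a: "a \<in> A" using A by blast
    have 2: "c \<sqsubseteq> \<Squnion>(squeeze L c d ` A)"
    proof (rule le_trans[OF _ up[OF a]])
      show "c \<sqsubseteq> squeeze L c d a"
        unfolding squeeze_def using A'[OF a] c d by (intro join_right) auto
    qed (use A'[OF a] c d sS in auto)
    show "squeeze L c d (\<Squnion>A) \<sqsubseteq> \<Squnion>(squeeze L c d ` A)"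
      unfolding squeeze_def[of L c d "\<Squnion>A"] using 1 2 sA sS c d by (intro join_le) auto
    show "\<Squnion>(squeeze L c d ` A) \<sqsubseteq> squeeze L c d (\<Squnion>A)"
    proof (rule sup_least)
      fix x assume "x \<in> squeeze L c d ` A"
      then obtain a where a: "a \<in> A" "x = squeeze L c d a" by blast
      have "a \<sqinter> d \<sqsubseteq> squeeze L c d (\<Squnion>A)"
      proof (rule le_trans)
        show "a \<sqinter> d \<sqsubseteq> \<Squnion>A \<sqinter> d"
          using a A sA A'[OF a(1)] d by (intro meet_mono sup_upper) auto
        show "\<Squnion>A \<sqinter> d \<sqsubseteq> squeeze L c d (\<Squnion>A)"
          unfolding squeeze_def using sA c d by (intro join_left) auto
      qed (use A'[OF a(1)] c d sA in auto)
      moreover have "c \<sqsubseteq> squeeze L c d (\<Squnion>A)"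
        unfolding squeeze_def using sA c d by (intro join_right) auto
      ultimately show "x \<sqsubseteq> squeeze L c d (\<Squnion>A)"
        unfolding a(2) squeeze_def[of L c d a] using A'[OF a(1)] c d sA by (intro join_le) auto
    qed (use cl sA c d in auto)
  qed (use sA sS c d in auto)
qed

lemma squeeze_join:
  assumes "x \<in> carrier L" "y \<in> carrier L" "c \<in> carrier L" "d \<in> carrier L"
  shows "squeeze L c d (x \<squnion> y) = squeeze L c d x \<squnion> squeeze L c d y"
  using squeeze_sup[of "{x, y}" c d] assms by (simp add: join_def)

lemma meet_le_join: "x \<in> carrier L \<Longrightarrow> y \<in> carrier L \<Longrightarrow> x \<sqinter> y \<sqsubseteq> x \<squnion> y"
  by (rule le_trans[OF meet_left join_left]) auto

lemma squeeze_self: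
  assumes "x \<in> carrier L" "y \<in> carrier L"
  shows "squeeze L (x \<sqinter> y) (x \<squnion> y) x = x" "squeeze L (x \<sqinter> y) (x \<squnion> y) y = y"
  using assms by (simp_all add: squeeze_def meet_absorb1 join_left join_right
      join_absorb2 meet_left meet_right)

lemma lattice_congruence_squeeze:
  assumes D: "lattice_congruence L D" and c: "c \<in> carrier L" and d: "d \<in> carrier L"
  shows "lattice_congruence L
    {(x, y) \<in> carrier L \<times> carrier L. (squeeze L c d x, squeeze L c d y) \<in> D}"
proof (rule lattice_congruenceI, goal_cases)
  case (2 x) then show ?case using congruence_refl[OF D] c d by simp
next
  case (3 x y) then show ?case using congruence_sym[OF D] by simp
next
  case (4 x y z) then show ?case using congruence_trans[OF D] by blast
next
  case (5 x y x' y') then show ?case using congruence_meet[OF D] c d by (simp add: squeeze_meet)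
next
  case (6 x y x' y') then show ?case using congruence_join[OF D] c d by (simp add: squeeze_join)
qed auto

lemma meet_join_congruent:
  assumes C: "lattice_congruence L C" and xy: "(x, y) \<in> C"
  shows "(x \<sqinter> y, x \<squnion> y) \<in> C"
proof -
  have x: "x \<in> carrier L" "y \<in> carrier L" using congruence_closed[OF C] xy by auto
  have "(x \<sqinter> y, y) \<in> C" "(x \<squnion> y, y) \<in> C"
    using congruence_meet[OF C xy congruence_refl[OF C x(2)]]
      congruence_join[OF C xy congruence_refl[OF C x(2)]] x by simp_all
  then show ?thesis using congruence_trans[OF C] congruence_sym[OF C] by blast
qed

lemma congruent_from_meet_join:
  assumes C: "lattice_congruence L C" and x: "x \<in> carrier L" "y \<in> carrier L"
    and xy: "(x \<sqinter> y, x \<squnion> y) \<in> C"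
  shows "(x, y) \<in> C"
proof -
  have "((x \<sqinter> y) \<sqinter> x, (x \<squnion> y) \<sqinter> x) \<in> C" "((x \<sqinter> y) \<sqinter> y, (x \<squnion> y) \<sqinter> y) \<in> C"
    using congruence_meet[OF C xy] congruence_refl[OF C] x by auto
  then have "(x \<sqinter> y, x) \<in> C" "(x \<sqinter> y, y) \<in> C"
    using x by (simp_all add: meet_absorb2 meet_absorb1 join_left join_right meet_left meet_right)
  then show ?thesis using congruence_trans[OF C] congruence_sym[OF C] by blast
qed

text \<open>Two congruent elements form the ends of an interval that is collapsed by \<open>C\<close> and onto which
  squeezing acts trivially.\<close>

lemma congruence_imp_mp:
  assumes C: "lattice_congruence L C" shows "C \<inter> congruence_imp L C D \<subseteq> D"
proof clarify
  fix x y assume xy: "(x, y) \<in> C" "(x, y) \<in> congruence_imp L C D"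
  then have car: "x \<in> carrier L" "y \<in> carrier L" using congruence_closed[OF C] by auto
  have "(squeeze L (x \<sqinter> y) (x \<squnion> y) x, squeeze L (x \<sqinter> y) (x \<squnion> y) y) \<in> D"
    using xy(2) meet_join_congruent[OF C xy(1)] meet_le_join[OF car]
    unfolding congruence_imp_def by blast
  then show "(x, y) \<in> D" using squeeze_self car by simp
qed

text \<open>Squeezing to a pair of \<open>C\<close> respects every congruence \<open>X\<close>, and its values lie in an interval that
  \<open>C\<close> collapses, so pairs of \<open>X\<close> are sent into \<open>X \<inter> C\<close>.\<close>

lemma congruence_imp_greatest:
  assumes C: "lattice_congruence L C" and X: "lattice_congruence L X" and le: "X \<inter> C \<subseteq> D"
  shows "X \<subseteq> congruence_imp L C D"
proof clarify
  fix x y assume xy: "(x, y) \<in> X"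
  have car: "x \<in> carrier L" "y \<in> carrier L" using xy congruence_closed[OF X] by auto
  have "(squeeze L c d x, squeeze L c d y) \<in> D" if cd: "(c, d) \<in> C" for c d
  proof -
    have c: "c \<in> carrier L" "d \<in> carrier L" using cd congruence_closed[OF C] by auto
    have "(squeeze L c d x, squeeze L c d y) \<in> X"
      unfolding squeeze_def
      using congruence_join[OF X congruence_meet[OF X xy congruence_refl[OF X c(2)]]
          congruence_refl[OF X c(1)]] .
    moreover have "(squeeze L c d z, c) \<in> C" if z: "z \<in> carrier L" for z
    proof -
      have "((z \<sqinter> d) \<squnion> c, (z \<sqinter> c) \<squnion> c) \<in> C"
        using congruence_join[OF C congruence_meet[OF C congruence_refl[OF C z]
              congruence_sym[OF C cd]] congruence_refl[OF C c(1)]] .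
      then show ?thesis using z c by (simp add: squeeze_def join_absorb1 meet_right)
    qed
    then have "(squeeze L c d x, squeeze L c d y) \<in> C"
      using car congruence_trans[OF C] congruence_sym[OF C] by blast
    ultimately show ?thesis using le by blast
  qed
  then show "(x, y) \<in> congruence_imp L C D" using car unfolding congruence_imp_def by blast
qed

lemma nabla_squeeze:
  assumes "a \<in> carrier L"
  shows "nabla L a =
    {(x, y) \<in> carrier L \<times> carrier L. (squeeze L a \<top> x, squeeze L a \<top> y) \<in> Id_on (carrier L)}"
  using assms by (auto simp: nabla_def squeeze_def)

lemma delta_squeeze:
  assumes "a \<in> carrier L"
  shows "delta L a =
    {(x, y) \<in> carrier L \<times> carrier L. (squeeze L \<bottom> a x, squeeze L \<bottom> a y) \<in> Id_on (carrier L)}"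
  using assms by (auto simp: delta_def squeeze_def)

lemma lattice_congruence_Id: "lattice_congruence L (Id_on (carrier L))"
  by (rule lattice_congruenceI) auto

lemma lattice_congruence_nabla: "a \<in> carrier L \<Longrightarrow> lattice_congruence L (nabla L a)"
  unfolding nabla_squeeze by (intro lattice_congruence_squeeze lattice_congruence_Id) auto

lemma lattice_congruence_delta: "a \<in> carrier L \<Longrightarrow> lattice_congruence L (delta L a)"
  unfolding delta_squeeze by (intro lattice_congruence_squeeze lattice_congruence_Id) auto

lemma nabla_subset_iff:
  assumes C: "lattice_congruence L C" and a: "a \<in> carrier L"
  shows "nabla L a \<subseteq> C \<longleftrightarrow> (\<bottom>, a) \<in> C"
proof
  have "(\<bottom>, a) \<in> nabla L a" using a by (simp add: nabla_def)
  then show "nabla L a \<subseteq> C \<Longrightarrow> (\<bottom>, a) \<in> C" by blast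
  assume 0: "(\<bottom>, a) \<in> C"
  have *: "(x, x \<squnion> a) \<in> C" if "x \<in> carrier L" for x
    using congruence_join[OF C congruence_refl[OF C that] 0] that by simp
  show "nabla L a \<subseteq> C"
  proof clarify
    fix x y assume "(x, y) \<in> nabla L a"
    then have "(x, x \<squnion> a) \<in> C" "(y, x \<squnion> a) \<in> C" using *[of x] *[of y] by (auto simp: nabla_def)
    then show "(x, y) \<in> C" using congruence_trans[OF C] congruence_sym[OF C] by blast
  qed
qed

lemma delta_subset_iff:
  assumes C: "lattice_congruence L C" and a: "a \<in> carrier L"
  shows "delta L a \<subseteq> C \<longleftrightarrow> (a, \<top>) \<in> C"
proof
  have "(a, \<top>) \<in> delta L a" using a by (simp add: delta_def)
  then show "delta L a \<subseteq> C \<Longrightarrow> (a, \<top>) \<in> C" by blast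
  assume 0: "(a, \<top>) \<in> C"
  have *: "(x \<sqinter> a, x) \<in> C" if "x \<in> carrier L" for x
    using congruence_meet[OF C congruence_refl[OF C that] 0] that by simp
  show "delta L a \<subseteq> C"
  proof clarify
    fix x y assume "(x, y) \<in> delta L a"
    then have "(x \<sqinter> a, x) \<in> C" "(x \<sqinter> a, y) \<in> C" using *[of x] *[of y] by (auto simp: delta_def)
    then show "(x, y) \<in> C" using congruence_trans[OF C] congruence_sym[OF C] by blast
  qed
qed

text \<open>This identifies \<open>\<nabla>\<^sub>b \<inter> \<Delta>\<^sub>a\<close> as the congruence generated by the pair \<open>a \<le> b\<close>. If \<open>x \<squnion> b = y \<squnion> b\<close>,
  then \<open>x = x \<sqinter> (y \<squnion> b)\<close> is congruent to \<open>x \<sqinter> (y \<squnion> a) = (x \<sqinter> y) \<squnion> (x \<sqinter> a)\<close>, which is symmetric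
  in \<open>x\<close> and \<open>y\<close> if \<open>x \<sqinter> a = y \<sqinter> a\<close>.\<close>

lemma nabla_delta_subset_iff:
  assumes C: "lattice_congruence L C" and a: "a \<in> carrier L" and b: "b \<in> carrier L"
    and le: "a \<sqsubseteq> b"
  shows "nabla L b \<inter> delta L a \<subseteq> C \<longleftrightarrow> (a, b) \<in> C"
proof
  have "(a, b) \<in> nabla L b" "(a, b) \<in> delta L a"
    using a b le by (simp_all add: nabla_def delta_def join_absorb1 meet_absorb2)
  then show "nabla L b \<inter> delta L a \<subseteq> C \<Longrightarrow> (a, b) \<in> C" by blast
  assume ab: "(a, b) \<in> C"
  have *: "(x, (x \<sqinter> y) \<squnion> (x \<sqinter> a)) \<in> C"
    if x: "x \<in> carrier L" and y: "y \<in> carrier L" and xy: "x \<squnion> b = y \<squnion> b" for x y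
  proof -
    have "x = x \<sqinter> (x \<squnion> b)" using x b by (intro meet_absorb1[symmetric] join_left) auto
    moreover have "(x \<sqinter> (y \<squnion> b), x \<sqinter> (y \<squnion> a)) \<in> C"
      using congruence_meet[OF C congruence_refl[OF C x] congruence_join[OF C congruence_refl[OF C y]
            congruence_sym[OF C ab]]] .
    moreover have "x \<sqinter> (y \<squnion> a) = (x \<sqinter> y) \<squnion> (x \<sqinter> a)" using x y a by (rule meet_join_distrib)
    ultimately show ?thesis using xy by simp
  qed
  show "nabla L b \<inter> delta L a \<subseteq> C"
  proof clarify
    fix x y assume "(x, y) \<in> nabla L b" "(x, y) \<in> delta L a"
    then have xy: "x \<in> carrier L" "y \<in> carrier L" "x \<squnion> b = y \<squnion> b" "x \<sqinter> a = y \<sqinter> a"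
      unfolding nabla_def delta_def by blast+
    have "(x, (x \<sqinter> y) \<squnion> (x \<sqinter> a)) \<in> C" "(y, (x \<sqinter> y) \<squnion> (x \<sqinter> a)) \<in> C"
      using *[OF xy(1-3)] *[OF xy(2,1) xy(3)[symmetric]] xy(4) meet_comm[of L y x] by simp_all
    then show "(x, y) \<in> C" using congruence_trans[OF C] congruence_sym[OF C] by blast
  qed
qed

lemma nabla_inter:
  assumes "a \<in> carrier L" "b \<in> carrier L" shows "nabla L a \<inter> nabla L b = nabla L (a \<sqinter> b)"
proof
  show "nabla L a \<inter> nabla L b \<subseteq> nabla L (a \<sqinter> b)"
    unfolding nabla_def using assms by (clarsimp simp: join_meet_distrib)
  have "(\<bottom>, a \<sqinter> b) \<in> nabla L a" "(\<bottom>, a \<sqinter> b) \<in> nabla L b"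
    using assms by (simp_all add: nabla_def join_absorb1 meet_left meet_right)
  then show "nabla L (a \<sqinter> b) \<subseteq> nabla L a \<inter> nabla L b"
    using assms by (simp add: nabla_subset_iff lattice_congruence_nabla)
qed

lemma delta_inter:
  assumes "a \<in> carrier L" "b \<in> carrier L" shows "delta L a \<inter> delta L b = delta L (a \<squnion> b)"
proof
  show "delta L a \<inter> delta L b \<subseteq> delta L (a \<squnion> b)"
    unfolding delta_def using assms by (clarsimp simp: meet_join_distrib)
  have "(a \<squnion> b, \<top>) \<in> delta L a" "(a \<squnion> b, \<top>) \<in> delta L b"
    using assms by (simp_all add: delta_def meet_absorb2 join_left join_right)
  then show "delta L (a \<squnion> b) \<subseteq> delta L a \<inter> delta L b"
    using assms by (simp add: delta_subset_iff lattice_congruence_delta)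
qed

lemma nabla_inter_delta:
  assumes a: "a \<in> carrier L" shows "nabla L a \<inter> delta L a = Id_on (carrier L)"
proof
  show "nabla L a \<inter> delta L a \<subseteq> Id_on (carrier L)"
    by (rule nabla_delta_subset_iff[OF lattice_congruence_Id a a le_refl[OF a], THEN iffD2])
      (rule Id_onI[OF a])
qed (auto simp: nabla_def delta_def)

lemma nabla_top: "nabla L \<top> = carrier L \<times> carrier L"
  by (auto simp: nabla_def)

lemma delta_bottom: "delta L \<bottom> = carrier L \<times> carrier L"
  by (auto simp: delta_def)

lemma nabla_subset_nabla_iff:
  assumes "a \<in> carrier L" "b \<in> carrier L" shows "nabla L a \<subseteq> nabla L b \<longleftrightarrow> a \<sqsubseteq> b"
  using assms le_iff_meet[OF assms] nabla_subset_iff[OF lattice_congruence_nabla[OF assms(2)] assms(1)]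
  by (auto simp: nabla_def)

lemma nabla_inj:
  assumes "a \<in> carrier L" "b \<in> carrier L" "nabla L a = nabla L b" shows "a = b"
  using assms nabla_subset_nabla_iff[of a b] nabla_subset_nabla_iff[of b a]
  by (intro le_antisym) simp_all

lemma full_congruence_iff:
  assumes C: "lattice_congruence L C" shows "C = carrier L \<times> carrier L \<longleftrightarrow> (\<bottom>, \<top>) \<in> C"
  using nabla_subset_iff[OF C top_closed] congruence_closed[OF C] unfolding nabla_top by blast

end

section \<open>The biframe of a family of congruences\<close>

text \<open>The properties shared by lattice congruences and frame congruences from which everything about
  their biframes follows, apart from compactness. Closure under pullback along squeezing maps yields
  the \<open>\<nabla>\<^sub>a\<close>, the \<open>\<Delta>\<^sub>a\<close> and the implication.\<close>

locale congruence_family = frame L for L :: "('a, 'm) gorder_scheme" (structure) +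
  fixes \<C> :: "('a \<times> 'a) set set"
  assumes family_congruence: "C \<in> \<C> \<Longrightarrow> lattice_congruence L C"
    and family_Id: "Id_on (carrier L) \<in> \<C>"
    and family_full: "carrier L \<times> carrier L \<in> \<C>"
    and family_Inter: "S \<subseteq> \<C> \<Longrightarrow> S \<noteq> {} \<Longrightarrow> \<Inter>S \<in> \<C>"
    and family_squeeze: "\<lbrakk>D \<in> \<C>; c \<in> carrier L; d \<in> carrier L\<rbrakk> \<Longrightarrow>
      {(x, y) \<in> carrier L \<times> carrier L. (squeeze L c d x, squeeze L c d y) \<in> D} \<in> \<C>"
begin

definition gen :: "('a \<times> 'a) set \<Rightarrow> ('a \<times> 'a) set" where
  "gen R = \<Inter>{\<theta>. \<theta> \<in> \<C> \<and> R \<subseteq> \<theta>}"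

lemma gen_upper: "R \<subseteq> gen R"
  unfolding gen_def by blast

lemma gen_least: "\<theta> \<in> \<C> \<Longrightarrow> R \<subseteq> \<theta> \<Longrightarrow> gen R \<subseteq> \<theta>"
  unfolding gen_def by blast

lemma gen_in:
  assumes "R \<subseteq> carrier L \<times> carrier L" shows "gen R \<in> \<C>"
  unfolding gen_def using assms family_full by (intro family_Inter) auto

lemma family_closed: "C \<in> \<C> \<Longrightarrow> C \<subseteq> carrier L \<times> carrier L"
  using congruence_closed family_congruence by blast

lemma Union_closed: "A \<subseteq> \<C> \<Longrightarrow> \<Union>A \<subseteq> carrier L \<times> carrier L"
  using family_closed by blast

lemma gen_Union_in: "A \<subseteq> \<C> \<Longrightarrow> gen (\<Union>A) \<in> \<C>"
  by (intro gen_in Union_closed)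

lemma family_inter: "C \<in> \<C> \<Longrightarrow> D \<in> \<C> \<Longrightarrow> C \<inter> D \<in> \<C>"
  using family_Inter[of "{C, D}"] by auto

lemma family_nabla: "a \<in> carrier L \<Longrightarrow> nabla L a \<in> \<C>"
  unfolding nabla_squeeze by (intro family_squeeze family_Id) auto

lemma family_delta: "a \<in> carrier L \<Longrightarrow> delta L a \<in> \<C>"
  unfolding delta_squeeze by (intro family_squeeze family_Id) auto

lemma gen_nabla: "a \<in> carrier L \<Longrightarrow> gen {(\<bottom>, a)} = nabla L a"
proof
  assume a: "a \<in> carrier L"
  have g: "gen {(\<bottom>, a)} \<in> \<C>" using a by (intro gen_in) auto
  show "gen {(\<bottom>, a)} \<subseteq> nabla L a"
    using a gen_least[OF family_nabla[OF a]] by (simp add: nabla_def)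
  show "nabla L a \<subseteq> gen {(\<bottom>, a)}"
    using gen_upper[of "{(\<bottom>, a)}"] nabla_subset_iff[OF family_congruence[OF g] a] by blast
qed

lemma gen_delta: "a \<in> carrier L \<Longrightarrow> gen {(a, \<top>)} = delta L a"
proof
  assume a: "a \<in> carrier L"
  have g: "gen {(a, \<top>)} \<in> \<C>" using a by (intro gen_in) auto
  show "gen {(a, \<top>)} \<subseteq> delta L a"
    using a gen_least[OF family_delta[OF a]] by (simp add: delta_def)
  show "delta L a \<subseteq> gen {(a, \<top>)}"
    using gen_upper[of "{(a, \<top>)}"] delta_subset_iff[OF family_congruence[OF g] a] by blast
qed

text \<open>Each condition in the definition of the implication is a preimage under a squeezing map.\<close>

lemma family_imp:
  assumes C: "lattice_congruence L C" and D: "D \<in> \<C>"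
  shows "congruence_imp L C D \<in> \<C>"
proof -
  let ?P = "\<lambda>(c, d). {(x, y) \<in> carrier L \<times> carrier L. (squeeze L c d x, squeeze L c d y) \<in> D}"
  let ?S = "?P ` {(c, d) \<in> C. c \<sqsubseteq> d}"
  have "(\<bottom>, \<bottom>) \<in> C" using congruence_refl[OF C] by simp
  then have ne: "?S \<noteq> {}" by force
  have "?S \<subseteq> \<C>"
    using congruence_closed[OF C] family_squeeze[OF D] by auto
  then have "\<Inter>?S \<in> \<C>" using ne by (rule family_Inter)
  also have "\<Inter>?S = congruence_imp L C D"
    using ne unfolding congruence_imp_def by auto
  finally show ?thesis .
qed

text \<open>Residuation turns the bound on \<open>X \<inter> C\<close> into a bound on \<open>X\<close> by a member of the family, and such a
  bound extends from all \<open>X\<close> to the congruence they generate. Since \<open>C\<close> and the \<open>X\<close> are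
  lattice congruences and only \<open>D\<close> is in the family, this also compares lattice congruences with
  frame congruences.\<close>

lemma inter_gen_subset:
  assumes C: "lattice_congruence L C" and D: "D \<in> \<C>" and R: "\<And>X. X \<in> A \<Longrightarrow> lattice_congruence L X"
    and le: "\<And>X. X \<in> A \<Longrightarrow> X \<inter> C \<subseteq> D"
  shows "C \<inter> gen (\<Union>A) \<subseteq> D"
proof -
  have "gen (\<Union>A) \<subseteq> congruence_imp L C D"
    using congruence_imp_greatest[OF C R le] by (intro gen_least family_imp C D) blast
  then show ?thesis using congruence_imp_mp[OF C] by blast
qed

context
  fixes M :: "(('a \<times> 'a) set, 'n) gorder_scheme"
  assumes M: "carrier M = \<C>" "eq M = (=)" "le M = (\<subseteq>)"
begin

lemma inclusion_partial_order: "partial_order M"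
  by unfold_locales (auto simp: M)

lemma inclusion_complete_lattice: "complete_lattice M"
proof -
  interpret M: partial_order M by (rule inclusion_partial_order)
  show ?thesis
  proof (rule M.complete_lattice_criterion1)
    show "\<exists>g. greatest M g (carrier M)"
      by (rule exI[of _ "carrier L \<times> carrier L"])
        (use family_full family_closed in \<open>auto simp: greatest_def M\<close>)
    fix A assume "A \<subseteq> carrier M" "A \<noteq> {}"
    then show "\<exists>i. greatest M i (Lower M A)"
      using family_Inter[of A] by (intro exI[of _ "\<Inter>A"]) (auto simp: greatest_def Lower_def M)
  qed
qed

lemma inclusion_sup:
  assumes A: "A \<subseteq> \<C>" shows "\<Squnion>\<^bsub>M\<^esub>A = gen (\<Union>A)"
proof -
  interpret M: complete_lattice M by (rule inclusion_complete_lattice)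
  have Ac: "A \<subseteq> carrier M" using A M by simp
  have "\<Squnion>\<^bsub>M\<^esub>A \<in> \<C>" using M.sup_closed[OF Ac] M by simp
  then have "gen (\<Union>A) \<subseteq> \<Squnion>\<^bsub>M\<^esub>A"
    using M.sup_upper[OF Ac] M by (intro gen_least) auto
  moreover have "\<Squnion>\<^bsub>M\<^esub>A \<subseteq> gen (\<Union>A)"
    using M.sup_least[OF Ac, of "gen (\<Union>A)"] gen_upper[of "\<Union>A"] gen_Union_in[OF A] M by auto
  ultimately show ?thesis by blast
qed

lemma inclusion_meet:
  assumes C: "C \<in> \<C>" "D \<in> \<C>" shows "C \<sqinter>\<^bsub>M\<^esub> D = C \<inter> D"
proof -
  interpret M: complete_lattice M by (rule inclusion_complete_lattice)
  have c: "C \<in> carrier M" "D \<in> carrier M" "C \<inter> D \<in> carrier M" using C M family_inter by auto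
  show ?thesis
    using M.meet_left[OF c(1,2)] M.meet_right[OF c(1,2)] M.meet_le[OF _ _ c(1,2,3)] M
    by (simp add: subset_antisym)
qed

lemma inclusion_join:
  assumes C: "C \<in> \<C>" "D \<in> \<C>" shows "C \<squnion>\<^bsub>M\<^esub> D = gen (C \<union> D)"
  using inclusion_sup[of "{C, D}"] C by (simp add: join_def)

lemma inclusion_bottom: "\<bottom>\<^bsub>M\<^esub> = Id_on (carrier L)"
proof -
  interpret M: complete_lattice M by (rule inclusion_complete_lattice)
  have "\<bottom>\<^bsub>M\<^esub> \<in> \<C>" using M.bottom_closed M by simp
  then have "Id_on (carrier L) \<subseteq> \<bottom>\<^bsub>M\<^esub>"
    using congruence_refl[OF family_congruence] by (auto elim!: Id_onE)
  then show ?thesis using M.bottom_lower[of "Id_on (carrier L)"] M family_Id by auto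
qed

lemma inclusion_top: "\<top>\<^bsub>M\<^esub> = carrier L \<times> carrier L"
proof -
  interpret M: complete_lattice M by (rule inclusion_complete_lattice)
  have "\<top>\<^bsub>M\<^esub> \<in> \<C>" using M.top_closed M by simp
  then show ?thesis
    using M.top_higher[of "carrier L \<times> carrier L"] M family_full family_closed by auto
qed

lemma inclusion_frame: "frame M"
proof -
  interpret M: complete_lattice M by (rule inclusion_complete_lattice)
  show ?thesis
  proof (intro frame.intro frame_axioms.intro M.complete_lattice_axioms)
    fix C A assume "C \<in> carrier M" "A \<subseteq> carrier M"
    then have C: "C \<in> \<C>" and A: "A \<subseteq> \<C>" using M by auto
    have CA: "(\<lambda>X. C \<sqinter>\<^bsub>M\<^esub> X) ` A = (\<lambda>X. C \<inter> X) ` A"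
      using C A inclusion_meet by (auto simp: image_iff subset_iff)
    have CA': "(\<lambda>X. C \<inter> X) ` A \<subseteq> \<C>" using C A family_inter by blast
    have "C \<inter> gen (\<Union>A) = gen (\<Union>((\<lambda>X. C \<inter> X) ` A))" (is "_ = gen ?U")
    proof
      have "X \<inter> C \<subseteq> gen ?U" if "X \<in> A" for X
        using gen_upper[of ?U] that by blast
      then show "C \<inter> gen (\<Union>A) \<subseteq> gen ?U"
        using C A family_congruence by (intro inter_gen_subset gen_Union_in CA') auto
      show "gen ?U \<subseteq> C \<inter> gen (\<Union>A)"
        using gen_upper[of "\<Union>A"] by (intro gen_least family_inter C gen_Union_in A) blast
    qed
    then show "C \<sqinter>\<^bsub>M\<^esub> \<Squnion>\<^bsub>M\<^esub>A = \<Squnion>\<^bsub>M\<^esub>((\<lambda>X. C \<sqinter>\<^bsub>M\<^esub> X) ` A)"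
      unfolding CA using C A CA' gen_Union_in by (simp add: inclusion_sup inclusion_meet)
  qed
qed

lemma subframe_generated_nabla:
  "subframe_generated M (nabla L ` carrier L) = {gen (\<Union>a\<in>A. nabla L a) |A. A \<subseteq> carrier L}"
proof -
  interpret M: frame M by (rule inclusion_frame)
  have "subframe_generated M (nabla L ` carrier L) = {\<Squnion>\<^bsub>M\<^esub>A |A. A \<subseteq> nabla L ` carrier L}"
  proof (rule M.subframe_generated_base)
    show "nabla L ` carrier L \<subseteq> carrier M" using family_nabla M by auto
    show "\<top>\<^bsub>M\<^esub> \<in> nabla L ` carrier L"
      unfolding inclusion_top nabla_top[symmetric] by blast
  qed (auto simp: inclusion_meet family_nabla nabla_inter)
  also have "\<dots> = {\<Squnion>\<^bsub>M\<^esub>(nabla L ` A) |A. A \<subseteq> carrier L}"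
    by (auto simp: subset_image_iff)
  also have "\<dots> = {gen (\<Union>a\<in>A. nabla L a) |A. A \<subseteq> carrier L}"
  proof -
    have "\<Squnion>\<^bsub>M\<^esub>(nabla L ` A) = gen (\<Union>a\<in>A. nabla L a)" if "A \<subseteq> carrier L" for A
      by (rule inclusion_sup) (use that family_nabla in blast)
    then show ?thesis by (intro Collect_cong ex_cong1) auto
  qed
  finally show ?thesis .
qed

lemma subframe_generated_delta:
  "subframe_generated M (delta L ` carrier L) = {gen (\<Union>a\<in>A. delta L a) |A. A \<subseteq> carrier L}"
proof -
  interpret M: frame M by (rule inclusion_frame)
  have "subframe_generated M (delta L ` carrier L) = {\<Squnion>\<^bsub>M\<^esub>A |A. A \<subseteq> delta L ` carrier L}"
  proof (rule M.subframe_generated_base)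
    show "delta L ` carrier L \<subseteq> carrier M" using family_delta M by auto
    show "\<top>\<^bsub>M\<^esub> \<in> delta L ` carrier L"
      unfolding inclusion_top delta_bottom[symmetric] by blast
  qed (auto simp: inclusion_meet family_delta delta_inter)
  also have "\<dots> = {\<Squnion>\<^bsub>M\<^esub>(delta L ` A) |A. A \<subseteq> carrier L}"
    by (auto simp: subset_image_iff)
  also have "\<dots> = {gen (\<Union>a\<in>A. delta L a) |A. A \<subseteq> carrier L}"
  proof -
    have "\<Squnion>\<^bsub>M\<^esub>(delta L ` A) = gen (\<Union>a\<in>A. delta L a)" if "A \<subseteq> carrier L" for A
      by (rule inclusion_sup) (use that family_delta in blast)
    then show ?thesis by (intro Collect_cong ex_cong1) auto
  qed
  finally show ?thesis .
qed

end

abbreviation B :: "('a \<times> 'a) set biframe" where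
  "B \<equiv> congruence_biframe L \<C> gen"

lemma B_order: "carrier B = \<C>" "eq B = (=)" "le B = (\<subseteq>)"
  by (simp_all add: congruence_biframe_def)

lemmas B_frame = inclusion_frame[OF B_order]
  and B_sup = inclusion_sup[OF B_order]
  and B_meet = inclusion_meet[OF B_order]
  and B_join = inclusion_join[OF B_order]
  and B_top = inclusion_top[OF B_order]
  and B_bottom = inclusion_bottom[OF B_order]

lemma part1_B: "part1 B = {gen (\<Union>a\<in>A. nabla L a) |A. A \<subseteq> carrier L}"
  and part2_B: "part2 B = {gen (\<Union>a\<in>A. delta L a) |A. A \<subseteq> carrier L}"
proof -
  have I: "carrier (inclusion_order \<C>) = \<C>" "eq (inclusion_order \<C>) = (=)"
    "le (inclusion_order \<C>) = (\<subseteq>)"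
    by (simp_all add: inclusion_order_def)
  have *: "(\<lambda>a. gen {(\<bottom>, a)}) ` carrier L = nabla L ` carrier L"
    "(\<lambda>a. gen {(a, \<top>)}) ` carrier L = delta L ` carrier L"
    by (simp_all add: gen_nabla gen_delta cong: image_cong)
  show "part1 B = {gen (\<Union>a\<in>A. nabla L a) |A. A \<subseteq> carrier L}"
    using subframe_generated_nabla[OF I] * by (simp add: congruence_biframe_def)
  show "part2 B = {gen (\<Union>a\<in>A. delta L a) |A. A \<subseteq> carrier L}"
    using subframe_generated_delta[OF I] * by (simp add: congruence_biframe_def)
qed

lemma nabla_in_part1: "a \<in> carrier L \<Longrightarrow> nabla L a \<in> part1 B"
  and delta_in_part2: "a \<in> carrier L \<Longrightarrow> delta L a \<in> part2 B"
proof -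
  have *: "gen C = C" if "C \<in> \<C>" for C using gen_upper gen_least[OF that] by blast
  assume a: "a \<in> carrier L"
  show "nabla L a \<in> part1 B" "delta L a \<in> part2 B"
    unfolding part1_B part2_B using a *[OF family_nabla[OF a]] *[OF family_delta[OF a]]
    by (auto intro!: exI[of _ "{a}"])
qed

text \<open>A congruence is the join of the \<open>\<nabla>\<^sub>b \<inter> \<Delta>\<^sub>a\<close> for its pairs \<open>a \<le> b\<close>, so the two parts
  generate everything.\<close>

lemma biframe_B: "biframe B"
proof -
  interpret B: frame B by (rule B_frame)
  have p1: "part1 B = subframe_generated B (nabla L ` carrier L)"
    unfolding part1_B subframe_generated_nabla[OF B_order] ..
  have p2: "part2 B = subframe_generated B (delta L ` carrier L)"
    unfolding part2_B subframe_generated_delta[OF B_order] ..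
  have s1: "subframe (part1 B) B" and s2: "subframe (part2 B) B"
    unfolding p1 p2 by (rule B.subframe_subframe_generated, use family_nabla family_delta B_order in auto)+
  let ?G = "subframe_generated B (part1 B \<union> part2 B)"
  have cl: "part1 B \<union> part2 B \<subseteq> carrier B" using s1 s2 by (simp add: subframe_def)
  have G: "subframe ?G B" by (rule B.subframe_subframe_generated[OF cl])
  have "C \<in> ?G" if C: "C \<in> \<C>" for C
  proof -
    let ?T = "{nabla L b \<inter> delta L a |a b. (a, b) \<in> C \<and> a \<sqsubseteq> b}"
    have "?T \<subseteq> ?G"
    proof clarify
      fix a b assume "(a, b) \<in> C" "a \<sqsubseteq> b"
      then have ab: "a \<in> carrier L" "b \<in> carrier L" using family_closed[OF C] by auto
      have "nabla L b \<in> ?G" "delta L a \<in> ?G"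
        using ab nabla_in_part1 delta_in_part2 B.subset_subframe_generated by blast+
      then have "nabla L b \<sqinter>\<^bsub>B\<^esub> delta L a \<in> ?G" using G by (simp add: subframe_def)
      then show "nabla L b \<inter> delta L a \<in> ?G" using ab by (simp add: B_meet family_nabla family_delta)
    qed
    then have sup: "\<Squnion>\<^bsub>B\<^esub>?T \<in> ?G" using G by (simp add: subframe_def)
    have T: "?T \<subseteq> \<C>"
      using family_closed[OF C] by (auto intro!: family_inter family_nabla family_delta)
    have "gen (\<Union>?T) = C"
    proof
      show "gen (\<Union>?T) \<subseteq> C"
      proof (rule gen_least[OF C], rule Union_least)
        fix X assume "X \<in> ?T"
        then obtain a b where X: "X = nabla L b \<inter> delta L a" "(a, b) \<in> C" "a \<sqsubseteq> b" by blast
        then have "a \<in> carrier L" "b \<in> carrier L" using family_closed[OF C] by auto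
        then show "X \<subseteq> C" using nabla_delta_subset_iff[OF family_congruence[OF C]] X by simp
      qed
      show "C \<subseteq> gen (\<Union>?T)"
      proof clarify
        fix x y assume xy: "(x, y) \<in> C"
        then have c: "x \<in> carrier L" "y \<in> carrier L" using family_closed[OF C] by auto
        have g: "lattice_congruence L (gen (\<Union>?T))"
          using family_congruence gen_Union_in[OF T] by blast
        have "nabla L (x \<squnion> y) \<inter> delta L (x \<sqinter> y) \<subseteq> gen (\<Union>?T)"
          using gen_upper[of "\<Union>?T"] meet_join_congruent[OF family_congruence[OF C] xy]
            meet_le_join[OF c] by blast
        then have "(x \<sqinter> y, x \<squnion> y) \<in> gen (\<Union>?T)"
          using nabla_delta_subset_iff[OF g _ _ meet_le_join[OF c]] c by simp
        then show "(x, y) \<in> gen (\<Union>?T)" by (rule congruent_from_meet_join[OF g c])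
      qed
    qed
    then show ?thesis using sup B_sup[OF T] by simp
  qed
  then have "?G = carrier B" using G B_order by (auto simp: subframe_def)
  then show ?thesis unfolding biframe_def using s1 s2 B_frame by blast
qed

text \<open>\<open>\<nabla>\<^sub>a\<close> and \<open>\<Delta>\<^sub>a\<close> are complements, hence rather below themselves.\<close>

lemma nabla_join_delta:
  assumes a: "a \<in> carrier L" shows "gen (nabla L a \<union> delta L a) = carrier L \<times> carrier L"
proof -
  have g: "gen (nabla L a \<union> delta L a) \<in> \<C>"
    using gen_Union_in[of "{nabla L a, delta L a}"] family_nabla[OF a] family_delta[OF a] by simp
  have "(\<bottom>, a) \<in> gen (nabla L a \<union> delta L a)" "(a, \<top>) \<in> gen (nabla L a \<union> delta L a)"
    using gen_upper[of "nabla L a \<union> delta L a"] a by (auto simp: nabla_def delta_def)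
  then have "(\<bottom>, \<top>) \<in> gen (nabla L a \<union> delta L a)"
    by (rule congruence_trans[OF family_congruence[OF g]])
  then show ?thesis using full_congruence_iff[OF family_congruence[OF g]] by blast
qed

lemma rather_below_nabla:
  assumes a: "a \<in> carrier L" and C: "C \<in> \<C>" "nabla L a \<subseteq> C"
  shows "rather_below B (part2 B) (nabla L a) C"
proof -
  have "gen (nabla L a \<union> delta L a) \<subseteq> gen (C \<union> delta L a)"
    using C gen_upper[of "C \<union> delta L a"] unfolding gen_def by blast
  moreover have "gen (C \<union> delta L a) \<in> \<C>"
    using C gen_Union_in[of "{C, delta L a}"] family_delta[OF a] by simp
  ultimately have "gen (C \<union> delta L a) = carrier L \<times> carrier L"
    using nabla_join_delta[OF a] family_closed by blast
  then show ?thesis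
    unfolding rather_below_def using a C
    by (intro bexI[OF _ delta_in_part2[OF a]])
      (simp add: B_meet B_join B_bottom B_top family_nabla family_delta nabla_inter_delta)
qed

lemma rather_below_delta:
  assumes a: "a \<in> carrier L" and C: "C \<in> \<C>" "delta L a \<subseteq> C"
  shows "rather_below B (part1 B) (delta L a) C"
proof -
  have "gen (nabla L a \<union> delta L a) \<subseteq> gen (C \<union> nabla L a)"
    using C gen_upper[of "C \<union> nabla L a"] unfolding gen_def by blast
  moreover have "gen (C \<union> nabla L a) \<in> \<C>"
    using C gen_Union_in[of "{C, nabla L a}"] family_nabla[OF a] by simp
  ultimately have "gen (C \<union> nabla L a) = carrier L \<times> carrier L"
    using nabla_join_delta[OF a] family_closed by blast
  then show ?thesis
    unfolding rather_below_def using a C nabla_inter_delta[OF a]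
    by (intro bexI[OF _ nabla_in_part1[OF a]])
      (simp add: B_meet B_join B_bottom B_top family_nabla family_delta Int_commute)
qed

lemma regular_B: "regular_biframe B"
  unfolding regular_biframe_def
proof (intro conjI ballI biframe_B)
  fix C assume "C \<in> part1 B"
  then obtain A where A: "A \<subseteq> carrier L" "C = gen (\<Union>a\<in>A. nabla L a)" unfolding part1_B by blast
  have *: "nabla L ` A \<subseteq> \<C>" using A family_nabla by auto
  have C: "C \<in> \<C>" using gen_Union_in[OF *] A by simp
  have "rather_below B (part2 B) (nabla L a) C" if a: "a \<in> A" for a
    using a A C gen_upper by (intro rather_below_nabla) blast+
  then have "nabla L ` A \<subseteq> {x \<in> part1 B. rather_below B (part2 B) x C}"
    using A nabla_in_part1 by auto
  then show "\<exists>A\<subseteq>{x \<in> part1 B. rather_below B (part2 B) x C}. C = \<Squnion>\<^bsub>B\<^esub>A"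
    using A(2) B_sup[OF *] by blast
next
  fix C assume "C \<in> part2 B"
  then obtain A where A: "A \<subseteq> carrier L" "C = gen (\<Union>a\<in>A. delta L a)" unfolding part2_B by blast
  have *: "delta L ` A \<subseteq> \<C>" using A family_delta by auto
  have C: "C \<in> \<C>" using gen_Union_in[OF *] A by simp
  have "rather_below B (part1 B) (delta L a) C" if a: "a \<in> A" for a
    using a A C gen_upper by (intro rather_below_delta) blast+
  then have "delta L ` A \<subseteq> {x \<in> part2 B. rather_below B (part1 B) x C}"
    using A delta_in_part2 by auto
  then show "\<exists>A\<subseteq>{x \<in> part2 B. rather_below B (part1 B) x C}. C = \<Squnion>\<^bsub>B\<^esub>A"
    using A(2) B_sup[OF *] by blast
qed

end

section \<open>Lattice congruences and frame congruences\<close>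

lemma lattice_congruence_Inter:
  assumes "S \<noteq> {}" "\<And>C. C \<in> S \<Longrightarrow> lattice_congruence L C"
  shows "lattice_congruence L (\<Inter>S)"
proof (rule lattice_congruenceI, goal_cases)
  case 1 then show ?case using assms congruence_closed by blast
next
  case (2 x) then show ?case using assms congruence_refl by fast
next
  case (3 x y) then show ?case using assms congruence_sym by fast
next
  case (4 x y z)
  then have "(x, z) \<in> C" if "C \<in> S" for C
    using that congruence_trans[OF assms(2), of C x y z] by simp
  then show ?case by simp
next
  case (5 x y x' y')
  then have "(x \<sqinter>\<^bsub>L\<^esub> x', y \<sqinter>\<^bsub>L\<^esub> y') \<in> C" if "C \<in> S" for C
    using that congruence_meet[OF assms(2), of C x y x' y'] by simp
  then show ?case by simp
next
  case (6 x y x' y')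
  then have "(x \<squnion>\<^bsub>L\<^esub> x', y \<squnion>\<^bsub>L\<^esub> y') \<in> C" if "C \<in> S" for C
    using that congruence_join[OF assms(2), of C x y x' y'] by simp
  then show ?case by simp
qed

lemma frame_congruence_lattice:
  assumes C: "frame_congruence L C" shows "lattice_congruence L C"
proof -
  note c = C[unfolded frame_congruence_def]
  have "(x \<squnion>\<^bsub>L\<^esub> x', y \<squnion>\<^bsub>L\<^esub> y') \<in> C" if "(x, y) \<in> C" "(x', y') \<in> C" for x y x' y'
  proof -
    have "{(x, y), (x', y')} \<subseteq> C" using that by simp
    then have "(\<Squnion>\<^bsub>L\<^esub>(fst ` {(x, y), (x', y')}), \<Squnion>\<^bsub>L\<^esub>(snd ` {(x, y), (x', y')})) \<in> C"
      using c by blast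
    then show ?thesis by (simp add: join_def)
  qed
  then show ?thesis unfolding lattice_congruence_def using c by fast
qed

lemma frame_congruence_sup:
  "frame_congruence L C \<Longrightarrow> R \<subseteq> C \<Longrightarrow> (\<Squnion>\<^bsub>L\<^esub>(fst ` R), \<Squnion>\<^bsub>L\<^esub>(snd ` R)) \<in> C"
  by (simp add: frame_congruence_def)

lemma frame_congruenceI:
  assumes C: "lattice_congruence L C"
    and sup: "\<And>R. R \<subseteq> C \<Longrightarrow> (\<Squnion>\<^bsub>L\<^esub>(fst ` R), \<Squnion>\<^bsub>L\<^esub>(snd ` R)) \<in> C"
  shows "frame_congruence L C"
  using C sup unfolding lattice_congruence_def frame_congruence_def by blast

lemma frame_congruence_Inter:
  assumes "S \<noteq> {}" "\<And>C. C \<in> S \<Longrightarrow> frame_congruence L C"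
  shows "frame_congruence L (\<Inter>S)"
proof (rule frame_congruenceI)
  show "lattice_congruence L (\<Inter>S)"
    using assms frame_congruence_lattice by (intro lattice_congruence_Inter) blast+
  show "(\<Squnion>\<^bsub>L\<^esub>(fst ` R), \<Squnion>\<^bsub>L\<^esub>(snd ` R)) \<in> \<Inter>S" if "R \<subseteq> \<Inter>S" for R
  proof (rule InterI)
    fix C assume C: "C \<in> S"
    then have "R \<subseteq> C" using that by blast
    then show "(\<Squnion>\<^bsub>L\<^esub>(fst ` R), \<Squnion>\<^bsub>L\<^esub>(snd ` R)) \<in> C" by (rule frame_congruence_sup[OF assms(2)[OF C]])
  qed
qed

context frame
begin

lemma frame_congruence_Id: "frame_congruence L (Id_on (carrier L))"
proof (rule frame_congruenceI[OF lattice_congruence_Id])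
  fix R assume R: "R \<subseteq> Id_on (carrier L)"
  then have "fst ` R \<subseteq> carrier L" "snd ` R = fst ` R" by (auto intro!: image_cong)
  then show "(\<Squnion>(fst ` R), \<Squnion>(snd ` R)) \<in> Id_on (carrier L)" by auto
qed

lemma frame_congruence_full: "frame_congruence L (carrier L \<times> carrier L)"
proof (rule frame_congruenceI)
  show "lattice_congruence L (carrier L \<times> carrier L)"
    by (rule lattice_congruenceI) auto
  fix R assume "R \<subseteq> carrier L \<times> carrier L"
  then have "fst ` R \<subseteq> carrier L" "snd ` R \<subseteq> carrier L" by auto
  then show "(\<Squnion>(fst ` R), \<Squnion>(snd ` R)) \<in> carrier L \<times> carrier L" by simp
qed

lemma frame_congruence_squeeze:
  assumes D: "frame_congruence L D" and c: "c \<in> carrier L" and d: "d \<in> carrier L"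
  shows "frame_congruence L
    {(x, y) \<in> carrier L \<times> carrier L. (squeeze L c d x, squeeze L c d y) \<in> D}" (is "frame_congruence L ?E")
proof (rule frame_congruenceI)
  have D': "lattice_congruence L D" using D by (rule frame_congruence_lattice)
  show "lattice_congruence L ?E" using D' c d by (rule lattice_congruence_squeeze)
  fix R assume R: "R \<subseteq> ?E"
  then have cl: "fst ` R \<subseteq> carrier L" "snd ` R \<subseteq> carrier L" by auto
  have "(squeeze L c d (\<Squnion>(fst ` R)), squeeze L c d (\<Squnion>(snd ` R))) \<in> D"
  proof (cases "R = {}")
    case True
    then show ?thesis using congruence_refl[OF D'] c d by simp
  next
    case False
    let ?R = "(\<lambda>(x, y). (squeeze L c d x, squeeze L c d y)) ` R"
    have "?R \<subseteq> D" using R by auto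
    then have "(\<Squnion>(fst ` ?R), \<Squnion>(snd ` ?R)) \<in> D" by (rule frame_congruence_sup[OF D])
    moreover have "fst ` ?R = squeeze L c d ` fst ` R" "snd ` ?R = squeeze L c d ` snd ` R"
      by (simp_all add: image_image split_beta)
    ultimately show ?thesis using False cl c d by (simp add: squeeze_sup)
  qed
  then show "(\<Squnion>(fst ` R), \<Squnion>(snd ` R)) \<in> ?E" using cl by simp
qed

sublocale lat: congruence_family L "{\<theta>. lattice_congruence L \<theta>}"
  rewrites "congruence_family.gen {\<theta>. lattice_congruence L \<theta>} = lattice_congruence_generated L"
proof -
  show *: "congruence_family L {\<theta>. lattice_congruence L \<theta>}"
  proof (unfold_locales, goal_cases)
    case 2 then show ?case by (simp add: lattice_congruence_Id)
  next
    case 3 then show ?case by (simp add: frame_congruence_full frame_congruence_lattice)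
  next
    case (4 S) then show ?case using lattice_congruence_Inter[of S L] by blast
  next
    case (5 D c d) then show ?case using lattice_congruence_squeeze by simp
  qed simp
  show "congruence_family.gen {\<theta>. lattice_congruence L \<theta>} = lattice_congruence_generated L"
    by (rule ext) (simp add: congruence_family.gen_def[OF *] lattice_congruence_generated_def)
qed

sublocale frm: congruence_family L "{\<theta>. frame_congruence L \<theta>}"
  rewrites "congruence_family.gen {\<theta>. frame_congruence L \<theta>} = frame_congruence_generated L"
proof -
  show *: "congruence_family L {\<theta>. frame_congruence L \<theta>}"
  proof (unfold_locales, goal_cases)
    case 1 then show ?case by (simp add: frame_congruence_lattice)
  next
    case 2 then show ?case by (simp add: frame_congruence_Id)
  next
    case 3 then show ?case by (simp add: frame_congruence_full)
  next
    case (4 S) then show ?case using frame_congruence_Inter[of S L] by blast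
  next
    case (5 D c d) then show ?case using frame_congruence_squeeze by simp
  qed
  show "congruence_family.gen {\<theta>. frame_congruence L \<theta>} = frame_congruence_generated L"
    by (rule ext) (simp add: congruence_family.gen_def[OF *] frame_congruence_generated_def)
qed

text \<open>The two biframes of the theorem, in the form in which they are instances of the biframe of a
  family.\<close>

abbreviation LC :: "('a \<times> 'a) set biframe" where
  "LC \<equiv> congruence_biframe L {\<theta>. lattice_congruence L \<theta>} (lattice_congruence_generated L)"

abbreviation FC :: "('a \<times> 'a) set biframe" where
  "FC \<equiv> congruence_biframe L {\<theta>. frame_congruence L \<theta>} (frame_congruence_generated L)"

lemma lattice_congruence_biframe_eq: "lattice_congruence_biframe L = LC"
  by (simp add: lattice_congruence_biframe_def)

lemma frame_congruence_biframe_eq: "frame_congruence_biframe L = FC"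
  by (simp add: frame_congruence_biframe_def)

text \<open>The closure conditions on a lattice congruence are finitary, so the finite subjoins of a join
  form a directed family whose union is already a lattice congruence.\<close>

lemma lattice_congruence_finite_gen:
  assumes A: "\<And>C. C \<in> A \<Longrightarrow> lattice_congruence L C"
    and p: "p \<in> lattice_congruence_generated L (\<Union>A)"
  obtains F where "F \<subseteq> A" "finite F" "p \<in> lattice_congruence_generated L (\<Union>F)"
proof -
  let ?g = "\<lambda>F. lattice_congruence_generated L (\<Union>F)"
  let ?U = "\<Union>{?g F |F. F \<subseteq> A \<and> finite F}"
  have g: "lattice_congruence L (?g F)" if "F \<subseteq> A" for F
    using lat.gen_Union_in[of F] that A by auto
  have UI: "q \<in> ?U" if "q \<in> ?g F" "F \<subseteq> A" "finite F" for q F using that by blast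
  have UE: "\<exists>F. F \<subseteq> A \<and> finite F \<and> q \<in> ?g F \<and> q' \<in> ?g F" if q: "q \<in> ?U" "q' \<in> ?U" for q q'
  proof -
    obtain F F' where F: "F \<subseteq> A" "finite F" "q \<in> ?g F" "F' \<subseteq> A" "finite F'" "q' \<in> ?g F'"
      using q by blast
    have "?g F \<subseteq> ?g (F \<union> F')" "?g F' \<subseteq> ?g (F \<union> F')"
      unfolding lattice_congruence_generated_def by blast+
    then show ?thesis using F by (intro exI[of _ "F \<union> F'"]) auto
  qed
  have "lattice_congruence L ?U"
  proof (rule lattice_congruenceI, goal_cases)
    case 1
    show ?case using congruence_closed[OF g] by blast
  next
    case (2 x)
    show ?case by (rule UI[OF congruence_refl[OF g[of "{}"] 2]]) auto
  next
    case (3 x y)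
    then obtain F where F: "F \<subseteq> A" "finite F" "(x, y) \<in> ?g F" using UE[of "(x, y)" "(x, y)"] by blast
    show ?case by (rule UI[OF congruence_sym[OF g[OF F(1)] F(3)] F(1,2)])
  next
    case (4 x y z)
    then obtain F where F: "F \<subseteq> A" "finite F" "(x, y) \<in> ?g F" "(y, z) \<in> ?g F"
      using UE[of "(x, y)" "(y, z)"] by blast
    show ?case by (rule UI[OF congruence_trans[OF g[OF F(1)] F(3,4)] F(1,2)])
  next
    case (5 x y x' y')
    then obtain F where F: "F \<subseteq> A" "finite F" "(x, y) \<in> ?g F" "(x', y') \<in> ?g F"
      using UE[of "(x, y)" "(x', y')"] by blast
    show ?case by (rule UI[OF congruence_meet[OF g[OF F(1)] F(3,4)] F(1,2)])
  next
    case (6 x y x' y')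
    then obtain F where F: "F \<subseteq> A" "finite F" "(x, y) \<in> ?g F" "(x', y') \<in> ?g F"
      using UE[of "(x, y)" "(x', y')"] by blast
    show ?case by (rule UI[OF congruence_join[OF g[OF F(1)] F(3,4)] F(1,2)])
  qed
  moreover have "\<Union>A \<subseteq> ?U"
  proof (rule Union_least, rule subsetI)
    fix X q assume "X \<in> A" "q \<in> X"
    then show "q \<in> ?U" using lat.gen_upper[of "\<Union>{X}"] by (intro UI[of _ "{X}"]) auto
  qed
  ultimately have "?g A \<subseteq> ?U" by (intro lat.gen_least) auto
  then show thesis using p that by blast
qed

lemma compact_lattice_congruences: "compact_biframe LC"
  unfolding compact_biframe_def compact_frame_def
proof (intro conjI lat.biframe_B lat.B_frame allI impI)
  fix A assume "A \<subseteq> carrier LC" and top: "\<Squnion>\<^bsub>LC\<^esub>A = \<top>\<^bsub>LC\<^esub>"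
  then have A: "A \<subseteq> {\<theta>. lattice_congruence L \<theta>}" using lat.B_order by simp
  then have "(\<bottom>, \<top>) \<in> lattice_congruence_generated L (\<Union>A)"
    using top lat.B_sup[OF A] lat.B_top by simp
  then obtain F where F: "F \<subseteq> A" "finite F" "(\<bottom>, \<top>) \<in> lattice_congruence_generated L (\<Union>F)"
    using lattice_congruence_finite_gen[of A] A by blast
  then have "lattice_congruence_generated L (\<Union>F) = carrier L \<times> carrier L"
    using full_congruence_iff lat.gen_Union_in[of F] A by blast
  then have "\<Squnion>\<^bsub>LC\<^esub>F = \<top>\<^bsub>LC\<^esub>"
    using lat.B_sup[of F] lat.B_top F A by simp
  then show "\<exists>F\<subseteq>A. finite F \<and> \<Squnion>\<^bsub>LC\<^esub>F = \<top>\<^bsub>LC\<^esub>" using F by blast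
qed

section \<open>The frame congruence generated by a lattice congruence\<close>

lemma frame_generated_lattice_generated:
  assumes "R \<subseteq> carrier L \<times> carrier L"
  shows "frame_congruence_generated L (lattice_congruence_generated L R) =
    frame_congruence_generated L R"
proof
  have g: "frame_congruence_generated L R \<in> {\<theta>. frame_congruence L \<theta>}"
    using assms by (rule frm.gen_in)
  then have "lattice_congruence_generated L R \<subseteq> frame_congruence_generated L R"
    using frm.gen_upper by (intro lat.gen_least) (auto simp: frame_congruence_lattice)
  then show "frame_congruence_generated L (lattice_congruence_generated L R) \<subseteq>
      frame_congruence_generated L R"
    by (rule frm.gen_least[OF g])
  show "frame_congruence_generated L R \<subseteq>
      frame_congruence_generated L (lattice_congruence_generated L R)"
    using lat.gen_upper[of R] unfolding frame_congruence_generated_def by blast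
qed

lemma frame_congruence_generated_congruence:
  "lattice_congruence L C \<Longrightarrow> frame_congruence L (frame_congruence_generated L C)"
  using frm.gen_in[OF congruence_closed] by simp

text \<open>The generated congruence of \<open>C \<inter> D\<close> absorbs first \<open>D\<close> intersected with the closure of \<open>C\<close>, and
  then the closure of \<open>C\<close> intersected with the closure of \<open>D\<close>.\<close>

lemma frame_congruence_generated_inter:
  assumes C: "lattice_congruence L C" and D: "lattice_congruence L D"
  shows "frame_congruence_generated L (C \<inter> D) =
    frame_congruence_generated L C \<inter> frame_congruence_generated L D"
proof
  let ?g = "frame_congruence_generated L"
  show "?g (C \<inter> D) \<subseteq> ?g C \<inter> ?g D"
    unfolding frame_congruence_generated_def by blast
  have "lattice_congruence L (C \<inter> D)" using lat.family_inter C D by simp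
  then have E: "?g (C \<inter> D) \<in> {\<theta>. frame_congruence L \<theta>}"
    by (simp add: frame_congruence_generated_congruence)
  have gC: "lattice_congruence L (?g C)"
    by (rule frame_congruence_lattice[OF frame_congruence_generated_congruence[OF C]])
  have "D \<inter> ?g (\<Union>{C}) \<subseteq> ?g (C \<inter> D)"
    using C frm.gen_upper[of "C \<inter> D"] by (intro frm.inter_gen_subset[OF D E]) auto
  then have "?g C \<inter> ?g (\<Union>{D}) \<subseteq> ?g (C \<inter> D)"
    using D by (intro frm.inter_gen_subset[OF gC E]) auto
  then show "?g C \<inter> ?g D \<subseteq> ?g (C \<inter> D)" by simp
qed

lemma frame_congruence_generated_hom:
  "frame_hom LC FC (frame_congruence_generated L)"
proof -
  let ?g = "frame_congruence_generated L"
  interpret K: frame LC by (rule lat.B_frame)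
  interpret M: frame FC by (rule frm.B_frame)
  have top: "?g (carrier L \<times> carrier L) = carrier L \<times> carrier L"
    by (rule subset_antisym[OF frm.gen_least frm.gen_upper]) (simp_all add: frame_congruence_full)
  have sup: "?g (\<Squnion>\<^bsub>LC\<^esub>A) = \<Squnion>\<^bsub>FC\<^esub>(?g ` A)" if "A \<subseteq> carrier LC" for A
  proof -
    have A: "A \<subseteq> {\<theta>. lattice_congruence L \<theta>}" using that lat.B_order by simp
    have gA: "?g ` A \<subseteq> {\<theta>. frame_congruence L \<theta>}"
      using A frame_congruence_generated_congruence by blast
    have c: "\<Union>A \<subseteq> carrier L \<times> carrier L" using A by (rule lat.Union_closed)
    have "?g (\<Union>A) = ?g (\<Union>(?g ` A))"
    proof
      show "?g (\<Union>A) \<subseteq> ?g (\<Union>(?g ` A))"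
      proof (rule frm.gen_least[OF frm.gen_Union_in[OF gA]])
        show "\<Union>A \<subseteq> ?g (\<Union>(?g ` A))" using frm.gen_upper by blast
      qed
      show "?g (\<Union>(?g ` A)) \<subseteq> ?g (\<Union>A)"
      proof (rule frm.gen_least[OF frm.gen_in[OF c]], rule UN_least)
        fix C assume "C \<in> A"
        then show "?g C \<subseteq> ?g (\<Union>A)" unfolding frame_congruence_generated_def by blast
      qed
    qed
    then show ?thesis
      using lat.B_sup[OF A] frm.B_sup[OF gA] frame_generated_lattice_generated[OF c] by simp
  qed
  show ?thesis
    unfolding frame_hom_def meet_pres_def sup_pres_def
  proof (intro conjI lat.B_frame frm.B_frame K.lattice_axioms M.lattice_axioms
      K.complete_lattice_axioms M.complete_lattice_axioms ballI allI impI sup)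
    show "?g \<in> carrier LC \<rightarrow> carrier FC"
      using lat.B_order frm.B_order frame_congruence_generated_congruence by auto
    show "?g \<top>\<^bsub>LC\<^esub> = \<top>\<^bsub>FC\<^esub>"
      unfolding lat.B_top frm.B_top by (rule top)
    fix C D assume "C \<in> carrier LC" "D \<in> carrier LC"
    then have C: "lattice_congruence L C" "lattice_congruence L D" using lat.B_order by auto
    then show "?g (C \<sqinter>\<^bsub>LC\<^esub> D) = ?g C \<sqinter>\<^bsub>FC\<^esub> ?g D"
      using lat.B_meet[of C D] frm.B_meet[of "?g C" "?g D"] frame_congruence_generated_congruence
        frame_congruence_generated_inter[OF C] by simp
  qed
qed

lemma frame_congruence_generated_parts:
  "frame_congruence_generated L ` part1 LC = part1 FC"
  "frame_congruence_generated L ` part2 LC = part2 FC"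
proof -
  have "(\<Union>a\<in>A. nabla L a) \<subseteq> carrier L \<times> carrier L"
    "(\<Union>a\<in>A. delta L a) \<subseteq> carrier L \<times> carrier L" for A
    by (auto simp: nabla_def delta_def)
  note * = this[THEN frame_generated_lattice_generated]
  have image: "f ` {F A |A. A \<subseteq> S} = {G A |A. A \<subseteq> S}" if "\<And>A. f (F A) = G A"
    for f F G and S :: "'a set"
    using that by (auto simp: image_iff) metis
  show "frame_congruence_generated L ` part1 LC = part1 FC"
    "frame_congruence_generated L ` part2 LC = part2 FC"
    unfolding lat.part1_B frm.part1_B lat.part2_B frm.part2_B by (rule image, rule *)+
qed

lemma frame_congruence_generated_biframe_hom:
  "biframe_hom LC FC (frame_congruence_generated L)"
  unfolding biframe_hom_def
  using lat.biframe_B frm.biframe_B frame_congruence_generated_hom frame_congruence_generated_parts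
  by simp

lemma frame_congruence_generated_dense:
  "dense_biframe_hom LC FC (frame_congruence_generated L)"
  unfolding dense_biframe_hom_def
proof (intro conjI frame_congruence_generated_biframe_hom ballI impI)
  fix C assume C: "C \<in> carrier LC" "frame_congruence_generated L C = \<bottom>\<^bsub>FC\<^esub>"
  then have L: "lattice_congruence L C" and "C \<subseteq> Id_on (carrier L)"
    using lat.B_order frm.gen_upper[of C] frm.B_bottom by auto
  moreover have "Id_on (carrier L) \<subseteq> C"
    using congruence_refl[OF L] by (auto elim!: Id_onE)
  ultimately show "C = \<bottom>\<^bsub>LC\<^esub>"
    unfolding lat.B_bottom by blast
qed

lemma frame_congruence_generated_compactification:
  "biframe_compactification LC FC (frame_congruence_generated L)"
  unfolding biframe_compactification_def surjective_biframe_hom_def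
  using compact_lattice_congruences lat.regular_B frame_congruence_generated_dense
    frame_congruence_generated_biframe_hom frame_congruence_generated_parts by simp

end

section \<open>Prime filters\<close>

context frame
begin

definition prime_filter :: "'a set \<Rightarrow> bool" where
  "prime_filter P \<longleftrightarrow> P \<subseteq> carrier L \<and> \<top> \<in> P \<and> \<bottom> \<notin> P \<and>
     (\<forall>x\<in>carrier L. \<forall>y\<in>carrier L. x \<sqinter> y \<in> P \<longleftrightarrow> x \<in> P \<and> y \<in> P) \<and>
     (\<forall>x\<in>carrier L. \<forall>y\<in>carrier L. x \<squnion> y \<in> P \<longleftrightarrow> x \<in> P \<or> y \<in> P)"

definition ker :: "'a set \<Rightarrow> ('a \<times> 'a) set" where
  "ker P = {(x, y) \<in> carrier L \<times> carrier L. x \<in> P \<longleftrightarrow> y \<in> P}"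

lemma prime_filterD:
  assumes "prime_filter P"
  shows "P \<subseteq> carrier L" "\<top> \<in> P" "\<bottom> \<notin> P"
    and "x \<in> carrier L \<Longrightarrow> y \<in> carrier L \<Longrightarrow> x \<sqinter> y \<in> P \<longleftrightarrow> x \<in> P \<and> y \<in> P"
    and "x \<in> carrier L \<Longrightarrow> y \<in> carrier L \<Longrightarrow> x \<squnion> y \<in> P \<longleftrightarrow> x \<in> P \<or> y \<in> P"
  using assms by (simp_all add: prime_filter_def)

lemma prime_filter_mono:
  assumes "prime_filter P" "x \<in> P" "x \<sqsubseteq> y" "y \<in> carrier L" shows "y \<in> P"
proof -
  have x: "x \<in> carrier L" using assms(1,2) prime_filterD(1) by blast
  then have "x \<sqinter> y \<in> P" using assms meet_absorb1 by simp
  then show ?thesis using prime_filterD(4)[OF assms(1) x assms(4)] by blast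
qed

lemma lattice_congruence_ker:
  assumes P: "prime_filter P" shows "lattice_congruence L (ker P)"
  by (rule lattice_congruenceI) (simp_all add: ker_def prime_filterD[OF P] subset_iff split_paired_all)

text \<open>A filter of the preorder \<open>a \<le> b\<close> modulo \<open>C\<close> is automatically saturated under \<open>C\<close>; this
  is the prime filter theorem for the distributive lattice \<open>L / C\<close>, stated in \<open>L\<close>.\<close>

definition cfilter :: "('a \<times> 'a) set \<Rightarrow> 'a set \<Rightarrow> bool" where
  "cfilter C F \<longleftrightarrow> F \<subseteq> carrier L \<and> F \<noteq> {} \<and> (\<forall>x\<in>F. \<forall>y\<in>F. x \<sqinter> y \<in> F) \<and>
     (\<forall>x\<in>F. \<forall>y\<in>carrier L. (x \<sqinter> y, x) \<in> C \<longrightarrow> y \<in> F)"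

lemma cfilterD:
  assumes "cfilter C F"
  shows "F \<subseteq> carrier L" "F \<noteq> {}" "x \<in> F \<Longrightarrow> y \<in> F \<Longrightarrow> x \<sqinter> y \<in> F"
    "x \<in> F \<Longrightarrow> y \<in> carrier L \<Longrightarrow> (x \<sqinter> y, x) \<in> C \<Longrightarrow> y \<in> F"
  using assms by (simp_all add: cfilter_def)

text \<open>\<open>G\<close> is the filter modulo \<open>C\<close> generated by \<open>F\<close> and \<open>x\<close>.\<close>

lemma cfilter_extend:
  assumes C: "lattice_congruence L C" and F: "cfilter C F" and x: "x \<in> carrier L"
  defines "G \<equiv> {z \<in> carrier L. \<exists>f\<in>F. ((f \<sqinter> x) \<sqinter> z, f \<sqinter> x) \<in> C}"
  shows "cfilter C G" "F \<subseteq> G" "x \<in> G"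
proof -
  have Fc: "f \<in> carrier L" if "f \<in> F" for f using that cfilterD(1)[OF F] by blast
  show FG: "F \<subseteq> G"
  proof
    fix f assume f: "f \<in> F"
    have "(f \<sqinter> x) \<sqinter> f = f \<sqinter> x"
      using Fc[OF f] x by (intro meet_absorb1 meet_left) auto
    then have "((f \<sqinter> x) \<sqinter> f, f \<sqinter> x) \<in> C" using congruence_refl[OF C] Fc[OF f] x by simp
    then show "f \<in> G" unfolding G_def using f Fc[OF f] by blast
  qed
  show "x \<in> G"
  proof -
    obtain f where f: "f \<in> F" using cfilterD(2)[OF F] by blast
    have "(f \<sqinter> x) \<sqinter> x = f \<sqinter> x"
      using Fc[OF f] x by (intro meet_absorb1 meet_right) auto
    then have "((f \<sqinter> x) \<sqinter> x, f \<sqinter> x) \<in> C" using congruence_refl[OF C] Fc[OF f] x by simp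
    then show ?thesis unfolding G_def using f x by blast
  qed
  show "cfilter C G"
    unfolding cfilter_def
  proof (intro conjI ballI impI)
    show "G \<subseteq> carrier L" unfolding G_def by blast
    show "G \<noteq> {}" using \<open>x \<in> G\<close> by blast
  next
    fix z w assume "z \<in> G" "w \<in> G"
    then obtain f g where z: "z \<in> carrier L" "f \<in> F" "((f \<sqinter> x) \<sqinter> z, f \<sqinter> x) \<in> C"
      and w: "w \<in> carrier L" "g \<in> F" "((g \<sqinter> x) \<sqinter> w, g \<sqinter> x) \<in> C" unfolding G_def by blast
    have f: "f \<in> carrier L" and g: "g \<in> carrier L" using z w Fc by auto
    have "(((f \<sqinter> x) \<sqinter> z) \<sqinter> ((g \<sqinter> x) \<sqinter> w), (f \<sqinter> x) \<sqinter> (g \<sqinter> x)) \<in> C"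
      by (rule congruence_meet[OF C z(3) w(3)])
    moreover have "(f \<sqinter> x) \<sqinter> (g \<sqinter> x) = (f \<sqinter> g) \<sqinter> x"
      using f g x by (simp add: meet_assoc meet_absorb2 meet_right)
    moreover have "((f \<sqinter> x) \<sqinter> z) \<sqinter> ((g \<sqinter> x) \<sqinter> w) = ((f \<sqinter> x) \<sqinter> (g \<sqinter> x)) \<sqinter> (z \<sqinter> w)"
      using f g x z(1) w(1) by (simp add: meet_assoc meet_left_comm[of z])
    ultimately have "(((f \<sqinter> g) \<sqinter> x) \<sqinter> (z \<sqinter> w), (f \<sqinter> g) \<sqinter> x) \<in> C" by simp
    then show "z \<sqinter> w \<in> G"
      unfolding G_def using z(1) w(1) cfilterD(3)[OF F z(2) w(2)] by auto
  next
    fix z w assume "z \<in> G" and w: "w \<in> carrier L" "(z \<sqinter> w, z) \<in> C"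
    then obtain f where z: "z \<in> carrier L" "f \<in> F" "((f \<sqinter> x) \<sqinter> z, f \<sqinter> x) \<in> C" unfolding G_def by blast
    have f: "f \<in> carrier L" using z Fc by auto
    let ?k = "f \<sqinter> x"
    have k: "?k \<in> carrier L" using f x by simp
    have 1: "(?k \<sqinter> w, (?k \<sqinter> z) \<sqinter> w) \<in> C"
      using congruence_meet[OF C congruence_sym[OF C z(3)] congruence_refl[OF C w(1)]] .
    have 2: "((?k \<sqinter> z) \<sqinter> w, ?k \<sqinter> z) \<in> C"
      using congruence_meet[OF C congruence_refl[OF C k] w(2)] k z w by (simp add: meet_assoc)
    have "(?k \<sqinter> w, ?k) \<in> C"
      using congruence_trans[OF C congruence_trans[OF C 1 2] z(3)] .
    then show "w \<in> G" unfolding G_def using z w by blast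
  qed
qed

lemma cfilter_maximal:
  assumes C: "lattice_congruence L C" and a: "a \<in> carrier L" and b: "b \<in> carrier L"
    and ab: "(a \<sqinter> b, a) \<notin> C"
  obtains F where "cfilter C F" "a \<in> F" "b \<notin> F" "\<And>G. cfilter C G \<Longrightarrow> F \<subseteq> G \<Longrightarrow> b \<notin> G \<Longrightarrow> G = F"
proof -
  let ?S = "{F. cfilter C F \<and> a \<in> F \<and> b \<notin> F}"
  \<comment> \<open>The elements congruent to \<open>\<top>\<close> form the least filter; extending it by \<open>a\<close> gives the principal
    filter of \<open>a\<close>, which omits \<open>b\<close>.\<close>
  have top: "cfilter C {z \<in> carrier L. (z, \<top>) \<in> C}"
    unfolding cfilter_def
  proof (intro conjI ballI impI)
    show "{z \<in> carrier L. (z, \<top>) \<in> C} \<noteq> {}" using congruence_refl[OF C top_closed] by auto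
  next
    fix z w assume "z \<in> {z \<in> carrier L. (z, \<top>) \<in> C}" "w \<in> {z \<in> carrier L. (z, \<top>) \<in> C}"
    then show "z \<sqinter> w \<in> {z \<in> carrier L. (z, \<top>) \<in> C}"
      using congruence_meet[OF C, of z \<top> w \<top>] by simp
  next
    fix z w assume "z \<in> {z \<in> carrier L. (z, \<top>) \<in> C}" and w: "w \<in> carrier L" "(z \<sqinter> w, z) \<in> C"
    then have z: "z \<in> carrier L" "(z, \<top>) \<in> C" by auto
    have "(w, z \<sqinter> w) \<in> C"
      using congruence_meet[OF C congruence_sym[OF C z(2)] congruence_refl[OF C w(1)]] w by simp
    then have "(w, \<top>) \<in> C"
      using congruence_trans[OF C congruence_trans[OF C _ w(2)] z(2)] by blast
    then show "w \<in> {z \<in> carrier L. (z, \<top>) \<in> C}" using w by simp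
  qed auto
  define F0 where "F0 = {z \<in> carrier L. \<exists>f\<in>{z \<in> carrier L. (z, \<top>) \<in> C}. ((f \<sqinter> a) \<sqinter> z, f \<sqinter> a) \<in> C}"
  have F0: "cfilter C F0" "a \<in> F0" unfolding F0_def by (rule cfilter_extend[OF C top a])+
  have "b \<notin> F0"
  proof
    assume "b \<in> F0"
    then obtain f where f: "f \<in> carrier L" "(f, \<top>) \<in> C" "((f \<sqinter> a) \<sqinter> b, f \<sqinter> a) \<in> C"
      unfolding F0_def by auto
    have 1: "(f \<sqinter> a, a) \<in> C"
      using congruence_meet[OF C f(2) congruence_refl[OF C a]] a by simp
    have 2: "((f \<sqinter> a) \<sqinter> b, a \<sqinter> b) \<in> C"
      using congruence_meet[OF C 1 congruence_refl[OF C b]] .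
    show False
      using ab congruence_trans[OF C congruence_trans[OF C congruence_sym[OF C 2] f(3)] 1] by blast
  qed
  then have ne: "?S \<noteq> {}" using F0 by blast
  have "\<exists>F\<in>?S. \<forall>G\<in>?S. F \<subseteq> G \<longrightarrow> G = F"
  proof (rule subset_Zorn_nonempty[OF ne])
    fix \<X> assume X: "\<X> \<noteq> {}" "subset.chain ?S \<X>"
    then have XS: "cfilter C F" "a \<in> F" "b \<notin> F" if "F \<in> \<X>" for F
      using that by (auto simp: subset_chain_def)
    have "cfilter C (\<Union>\<X>)"
      unfolding cfilter_def
    proof (intro conjI ballI impI)
      show "\<Union>\<X> \<subseteq> carrier L" using XS(1) cfilterD(1) by blast
      show "\<Union>\<X> \<noteq> {}" using X XS by blast
    next
      fix x y assume "x \<in> \<Union>\<X>" "y \<in> \<Union>\<X>"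
      then obtain F G where F: "F \<in> \<X>" "x \<in> F" "G \<in> \<X>" "y \<in> G" by blast
      then have "F \<subseteq> G \<or> G \<subseteq> F" using X by (simp add: subset_chain_def)
      then obtain H where "H \<in> \<X>" "x \<in> H" "y \<in> H" using F by blast
      then show "x \<sqinter> y \<in> \<Union>\<X>" using cfilterD(3)[OF XS(1)] by blast
    next
      fix x y assume "x \<in> \<Union>\<X>" "y \<in> carrier L" "(x \<sqinter> y, x) \<in> C"
      then show "y \<in> \<Union>\<X>" using cfilterD(4)[OF XS(1)] by blast
    qed
    then show "\<Union>\<X> \<in> ?S" using X XS by blast
  qed
  then obtain F where F: "cfilter C F" "a \<in> F" "b \<notin> F" "\<forall>G\<in>?S. F \<subseteq> G \<longrightarrow> G = F" by blast
  show thesis by (rule that[OF F(1-3)]) (use F in blast)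
qed

text \<open>A filter that is maximal among those omitting \<open>b\<close> is prime: if it reaches \<open>b\<close> after adding \<open>x\<close> and
  also after adding \<open>y\<close>, then by distributivity it reaches \<open>b\<close> after adding \<open>x \<squnion> y\<close>.\<close>

lemma separating_filter:
  assumes C: "lattice_congruence L C" and a: "a \<in> carrier L" and b: "b \<in> carrier L"
    and ab: "(a \<sqinter> b, a) \<notin> C"
  obtains P where "prime_filter P" "C \<subseteq> ker P" "a \<in> P" "b \<notin> P"
proof -
  obtain P where P: "cfilter C P" "a \<in> P" "b \<notin> P"
    and max: "\<And>G. cfilter C G \<Longrightarrow> P \<subseteq> G \<Longrightarrow> b \<notin> G \<Longrightarrow> G = P"
    using cfilter_maximal[OF C a b ab] by blast
  have Pc: "x \<in> carrier L" if "x \<in> P" for x using that cfilterD(1)[OF P(1)] by blast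
  have up: "y \<in> P" if "x \<in> P" "y \<in> carrier L" "x \<sqsubseteq> y" for x y
    using cfilterD(4)[OF P(1) that(1,2)] congruence_refl[OF C Pc[OF that(1)]]
      meet_absorb1[OF Pc[OF that(1)] that(2,3)] by simp
  have reach: "\<exists>f\<in>P. ((f \<sqinter> x) \<sqinter> b, f \<sqinter> x) \<in> C" if x: "x \<in> carrier L" "x \<notin> P" for x
  proof (rule ccontr)
    assume no: "\<not> ?thesis"
    let ?G = "{z \<in> carrier L. \<exists>f\<in>P. ((f \<sqinter> x) \<sqinter> z, f \<sqinter> x) \<in> C}"
    have G: "cfilter C ?G" "P \<subseteq> ?G" "x \<in> ?G" by (rule cfilter_extend[OF C P(1) x(1)])+
    have "b \<notin> ?G" using no by blast
    then have "?G = P" by (rule max[OF G(1,2)])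
    then show False using G(3) x(2) by blast
  qed
  have "prime_filter P"
    unfolding prime_filter_def
  proof (intro conjI ballI)
    show "P \<subseteq> carrier L" using Pc by blast
    show "\<top> \<in> P" using up[OF P(2)] a by simp
    show "\<bottom> \<notin> P" using up[of \<bottom> b] P(3) b by auto
  next
    fix x y assume x: "x \<in> carrier L" and y: "y \<in> carrier L"
    show "x \<sqinter> y \<in> P \<longleftrightarrow> x \<in> P \<and> y \<in> P"
      using cfilterD(3)[OF P(1), of x y] up[of "x \<sqinter> y" x] up[of "x \<sqinter> y" y]
        meet_left[OF x y] meet_right[OF x y] x y by blast
    show "x \<squnion> y \<in> P \<longleftrightarrow> x \<in> P \<or> y \<in> P"
    proof
      show "x \<in> P \<or> y \<in> P \<Longrightarrow> x \<squnion> y \<in> P"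
        using up[of x "x \<squnion> y"] up[of y "x \<squnion> y"] join_left[OF x y] join_right[OF x y]
          join_closed[OF x y] by blast
      assume xy: "x \<squnion> y \<in> P"
      show "x \<in> P \<or> y \<in> P"
      proof (rule ccontr)
        assume "\<not> (x \<in> P \<or> y \<in> P)"
        then obtain f g where f: "f \<in> P" "((f \<sqinter> x) \<sqinter> b, f \<sqinter> x) \<in> C"
          and g: "g \<in> P" "((g \<sqinter> y) \<sqinter> b, g \<sqinter> y) \<in> C"
          using reach[OF x] reach[OF y] by blast
        have fc: "f \<in> carrier L" "g \<in> carrier L" using f g Pc by auto
        let ?p = "g \<sqinter> (f \<sqinter> x)" and ?q = "f \<sqinter> (g \<sqinter> y)"
        have "(g \<sqinter> ((f \<sqinter> x) \<sqinter> b), ?p) \<in> C" "(f \<sqinter> ((g \<sqinter> y) \<sqinter> b), ?q) \<in> C"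
          using congruence_meet[OF C congruence_refl[OF C fc(2)] f(2)]
            congruence_meet[OF C congruence_refl[OF C fc(1)] g(2)] by auto
        then have "(?p \<sqinter> b, ?p) \<in> C" "(?q \<sqinter> b, ?q) \<in> C"
          using fc x y b by (simp_all add: meet_assoc)
        then have "((?p \<sqinter> b) \<squnion> (?q \<sqinter> b), ?p \<squnion> ?q) \<in> C" by (rule congruence_join[OF C])
        moreover have "(?p \<sqinter> b) \<squnion> (?q \<sqinter> b) = (?p \<squnion> ?q) \<sqinter> b"
          using fc x y b by (intro meet_join_distrib2[symmetric]) auto
        moreover have "?p \<squnion> ?q = (f \<sqinter> g) \<sqinter> (x \<squnion> y)"
          using fc x y by (simp add: meet_join_distrib meet_assoc meet_left_comm[of g f])
        moreover have "(f \<sqinter> g) \<sqinter> (x \<squnion> y) \<in> P"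
          by (intro cfilterD(3)[OF P(1)] f g xy)
        ultimately have "b \<in> P" using cfilterD(4)[OF P(1) _ b] by simp
        then show False using P(3) by blast
      qed
    qed
  qed
  moreover have "C \<subseteq> ker P"
  proof clarify
    fix x y assume xy: "(x, y) \<in> C"
    then have c: "x \<in> carrier L" "y \<in> carrier L" using congruence_closed[OF C] by auto
    have "(x \<sqinter> y, x) \<in> C" "(y \<sqinter> x, y) \<in> C"
      using congruence_meet[OF C congruence_refl[OF C c(1)] congruence_sym[OF C xy]]
        congruence_meet[OF C congruence_refl[OF C c(2)] xy] c by simp_all
    then show "(x, y) \<in> ker P"
      unfolding ker_def using c cfilterD(4)[OF P(1), of x y] cfilterD(4)[OF P(1), of y x] by blast
  qed
  ultimately show thesis using that P by blast
qed

lemma lattice_congruence_separation: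
  assumes C: "lattice_congruence L C" and a: "a \<in> carrier L" and b: "b \<in> carrier L"
    and ab: "(a, b) \<notin> C"
  obtains P where "prime_filter P" "C \<subseteq> ker P" "(a, b) \<notin> ker P"
proof (cases "(a \<sqinter> b, a) \<in> C")
  case False
  then obtain P where "prime_filter P" "C \<subseteq> ker P" "a \<in> P" "b \<notin> P"
    by (rule separating_filter[OF C a b])
  then show thesis using that by (simp add: ker_def)
next
  case True
  then have "(b \<sqinter> a, b) \<notin> C"
    using ab congruence_trans[OF C congruence_sym[OF C True]] meet_comm[of L a b] by auto
  then obtain P where "prime_filter P" "C \<subseteq> ker P" "b \<in> P" "a \<notin> P"
    by (rule separating_filter[OF C b a])
  then show thesis using that by (simp add: ker_def)
qed

end

section \<open>Homomorphisms\<close>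

lemma frame_homD:
  assumes "frame_hom L M f"
  shows "frame L" "frame M"
    and "x \<in> carrier L \<Longrightarrow> f x \<in> carrier M"
    and "f \<top>\<^bsub>L\<^esub> = \<top>\<^bsub>M\<^esub>"
    and "x \<in> carrier L \<Longrightarrow> y \<in> carrier L \<Longrightarrow> f (x \<sqinter>\<^bsub>L\<^esub> y) = f x \<sqinter>\<^bsub>M\<^esub> f y"
    and "A \<subseteq> carrier L \<Longrightarrow> f (\<Squnion>\<^bsub>L\<^esub>A) = \<Squnion>\<^bsub>M\<^esub>(f ` A)"
  using assms by (auto simp: frame_hom_def meet_pres_def sup_pres_def)

lemma frame_hom_join:
  assumes "frame_hom L M f" "x \<in> carrier L" "y \<in> carrier L"
  shows "f (x \<squnion>\<^bsub>L\<^esub> y) = f x \<squnion>\<^bsub>M\<^esub> f y"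
  using frame_homD(6)[OF assms(1), of "{x, y}"] assms(2,3) by (simp add: join_def)

lemma frame_hom_bottom:
  assumes "frame_hom L M f" shows "f \<bottom>\<^bsub>L\<^esub> = \<bottom>\<^bsub>M\<^esub>"
  using frame_homD(6)[OF assms, of "{}"] frame_homD(1,2)[OF assms] by (simp add: frame.sup_empty)

lemma frame_homI:
  assumes L: "frame L" and M: "frame M"
    and "\<And>x. x \<in> carrier L \<Longrightarrow> f x \<in> carrier M"
    and "f \<top>\<^bsub>L\<^esub> = \<top>\<^bsub>M\<^esub>"
    and "\<And>x y. x \<in> carrier L \<Longrightarrow> y \<in> carrier L \<Longrightarrow> f (x \<sqinter>\<^bsub>L\<^esub> y) = f x \<sqinter>\<^bsub>M\<^esub> f y"
    and "\<And>A. A \<subseteq> carrier L \<Longrightarrow> f (\<Squnion>\<^bsub>L\<^esub>A) = \<Squnion>\<^bsub>M\<^esub>(f ` A)"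
  shows "frame_hom L M f"
proof -
  interpret L: frame L by (rule L)
  interpret M: frame M by (rule M)
  show ?thesis
    unfolding frame_hom_def meet_pres_def sup_pres_def
    using assms L.lattice_axioms M.lattice_axioms L.complete_lattice_axioms M.complete_lattice_axioms
    by simp
qed

lemma frame_hom_comp:
  assumes f: "frame_hom L M f" and g: "frame_hom M N g"
  shows "frame_hom L N (\<lambda>x. g (f x))"
proof (rule frame_homI)
  fix A assume A: "A \<subseteq> carrier L"
  have "f ` A \<subseteq> carrier M" using frame_homD(3)[OF f] A by auto
  then show "g (f (\<Squnion>\<^bsub>L\<^esub>A)) = \<Squnion>\<^bsub>N\<^esub>((\<lambda>x. g (f x)) ` A)"
    using frame_homD(6)[OF f A] frame_homD(6)[OF g] by (simp add: image_image)
qed (use frame_homD[OF f] frame_homD[OF g] in auto)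

lemma frame_hom_cong:
  assumes f: "frame_hom L M f" and eq: "\<And>x. x \<in> carrier L \<Longrightarrow> g x = f x"
  shows "frame_hom L M g"
proof -
  interpret L: frame L using frame_homD(1)[OF f] .
  show ?thesis
  proof (rule frame_homI)
    fix A assume A: "A \<subseteq> carrier L"
    then have "g ` A = f ` A" using eq by (intro image_cong) auto
    then show "g (\<Squnion>\<^bsub>L\<^esub>A) = \<Squnion>\<^bsub>M\<^esub>(g ` A)" using frame_homD(6)[OF f A] eq A by simp
  qed (use frame_homD[OF f] eq in auto)
qed

lemma biframe_hom_cong:
  assumes f: "biframe_hom L M f" and eq: "\<And>x. x \<in> carrier L \<Longrightarrow> g x = f x"
  shows "biframe_hom L M g"
proof -
  have "part1 L \<subseteq> carrier L" "part2 L \<subseteq> carrier L"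
    using f by (auto simp: biframe_hom_def biframe_def subframe_def)
  then have "g ` part1 L = f ` part1 L" "g ` part2 L = f ` part2 L"
    using eq by (auto intro!: image_cong)
  moreover have "frame_hom L M g"
    by (rule frame_hom_cong[of L M f]) (use f eq in \<open>auto simp: biframe_hom_def\<close>)
  ultimately show ?thesis using f by (simp add: biframe_hom_def)
qed

lemma frame_hom_eq_on_biframe:
  assumes N: "biframe N" and f: "frame_hom N M f" and g: "frame_hom N M g"
    and eq: "\<And>x. x \<in> part1 N \<union> part2 N \<Longrightarrow> f x = g x" and x: "x \<in> carrier N"
  shows "f x = g x"
proof -
  interpret N: frame N using frame_homD(1)[OF f] .
  let ?E = "{x \<in> carrier N. f x = g x}"
  have "subframe ?E N"
    unfolding subframe_def
  proof (intro conjI ballI allI impI)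
    fix A assume A: "A \<subseteq> ?E"
    then have "f ` A = g ` A" by (intro image_cong) auto
    moreover have "A \<subseteq> carrier N" using A by blast
    ultimately show "\<Squnion>\<^bsub>N\<^esub>A \<in> ?E" using frame_homD(6)[OF f] frame_homD(6)[OF g] by simp
  qed (use frame_homD[OF f] frame_homD[OF g] in auto)
  moreover have "part1 N \<union> part2 N \<subseteq> ?E"
    using eq N by (auto simp: biframe_def subframe_def)
  ultimately have "carrier N \<subseteq> ?E"
    using N.subframe_generated_least[of ?E "part1 N \<union> part2 N"] N by (simp add: biframe_def)
  then show ?thesis using x by blast
qed

text \<open>Density of \<open>h\<close> makes \<open>g1 x\<close> disjoint from \<open>g2 z\<close>, because \<open>h\<close> cannot tell \<open>g1\<close> from \<open>g2\<close>;
  and \<open>g2 y\<close> and \<open>g2 z\<close> join to the top.\<close>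

lemma dense_cancel_rather_below:
  assumes h: "dense_biframe_hom K M h" and g1: "frame_hom N K g1" and g2: "frame_hom N K g2"
    and eq: "\<And>x. x \<in> carrier N \<Longrightarrow> h (g1 x) = h (g2 x)"
    and x: "x \<in> carrier N" and y: "y \<in> carrier N" and z: "z \<in> carrier N"
    and xz: "x \<sqinter>\<^bsub>N\<^esub> z = \<bottom>\<^bsub>N\<^esub>" and yz: "y \<squnion>\<^bsub>N\<^esub> z = \<top>\<^bsub>N\<^esub>"
  shows "g1 x \<sqsubseteq>\<^bsub>K\<^esub> g2 y"
proof -
  have hf: "frame_hom K M h" and dense: "\<And>k. k \<in> carrier K \<Longrightarrow> h k = \<bottom>\<^bsub>M\<^esub> \<Longrightarrow> k = \<bottom>\<^bsub>K\<^esub>"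
    using h by (auto simp: dense_biframe_hom_def biframe_hom_def)
  interpret K: frame K using frame_homD(1)[OF hf] .
  note c1 = frame_homD(3)[OF g1] and c2 = frame_homD(3)[OF g2]
  have "h (g1 x \<sqinter>\<^bsub>K\<^esub> g2 z) = h (g1 (x \<sqinter>\<^bsub>N\<^esub> z))"
    using frame_homD(5)[OF hf] frame_homD(5)[OF g1] c1 c2 x z eq by simp
  also have "\<dots> = \<bottom>\<^bsub>M\<^esub>"
    using xz frame_hom_bottom[OF g1] frame_hom_bottom[OF hf] by simp
  finally have "g1 x \<sqinter>\<^bsub>K\<^esub> g2 z = \<bottom>\<^bsub>K\<^esub>" using dense c1 c2 x z by simp
  moreover have "g2 y \<squnion>\<^bsub>K\<^esub> g2 z = \<top>\<^bsub>K\<^esub>"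
    using frame_hom_join[OF g2 y z] yz frame_homD(4)[OF g2] by simp
  ultimately show ?thesis using c1 c2 x y z by (intro K.cover_le) auto
qed

lemma dense_cancel_part:
  assumes h: "dense_biframe_hom K M h" and g1: "frame_hom N K g1" and g2: "frame_hom N K g2"
    and eq: "\<And>x. x \<in> carrier N \<Longrightarrow> h (g1 x) = h (g2 x)"
    and P: "P \<subseteq> carrier N" and y: "y \<in> carrier N"
    and A: "A \<subseteq> {x \<in> carrier N. rather_below N P x y}" "y = \<Squnion>\<^bsub>N\<^esub>A"
  shows "g1 y \<sqsubseteq>\<^bsub>K\<^esub> g2 y"
proof -
  interpret K: frame K using frame_homD(2)[OF g1] .
  have Ac: "A \<subseteq> carrier N" using A by auto
  have "g1 x \<sqsubseteq>\<^bsub>K\<^esub> g2 y" if xA: "x \<in> A" for x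
  proof -
    obtain z where "z \<in> P" "x \<sqinter>\<^bsub>N\<^esub> z = \<bottom>\<^bsub>N\<^esub>" "y \<squnion>\<^bsub>N\<^esub> z = \<top>\<^bsub>N\<^esub>"
      using A(1) xA unfolding rather_below_def by blast
    then show ?thesis
      using xA Ac P y by (intro dense_cancel_rather_below[OF h g1 g2 eq]) auto
  qed
  then have "\<Squnion>\<^bsub>K\<^esub>(g1 ` A) \<sqsubseteq>\<^bsub>K\<^esub> g2 y"
    using frame_homD(3)[OF g1] frame_homD(3)[OF g2 y] Ac by (intro K.sup_least) auto
  then show ?thesis using frame_homD(6)[OF g1 Ac] A(2) by simp
qed

lemma dense_biframe_hom_cancel:
  assumes h: "dense_biframe_hom K M h" and N: "regular_biframe N"
    and g: "biframe_hom N K g1" "biframe_hom N K g2"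
    and eq: "\<And>x. x \<in> carrier N \<Longrightarrow> h (g1 x) = h (g2 x)" and x: "x \<in> carrier N"
  shows "g1 x = g2 x"
proof -
  have g1: "frame_hom N K g1" and g2: "frame_hom N K g2" using g by (auto simp: biframe_hom_def)
  have bN: "biframe N" using N by (simp add: regular_biframe_def)
  then have c: "part1 N \<subseteq> carrier N" "part2 N \<subseteq> carrier N" by (auto simp: biframe_def subframe_def)
  interpret K: frame K using frame_homD(2)[OF g1] .
  have "g1 y \<sqsubseteq>\<^bsub>K\<^esub> g2 y \<and> g2 y \<sqsubseteq>\<^bsub>K\<^esub> g1 y" if y: "y \<in> part1 N \<union> part2 N" for y
  proof -
    have yc: "y \<in> carrier N" using y c by auto
    obtain P A where "P \<subseteq> carrier N" "A \<subseteq> {x \<in> carrier N. rather_below N P x y}" "y = \<Squnion>\<^bsub>N\<^esub>A"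
    proof (cases "y \<in> part1 N")
      case True
      then obtain A where "A \<subseteq> {x \<in> part1 N. rather_below N (part2 N) x y}" "y = \<Squnion>\<^bsub>N\<^esub>A"
        using N unfolding regular_biframe_def by blast
      then show thesis using that[of "part2 N" A] c by blast
    next
      case False
      then obtain A where "A \<subseteq> {x \<in> part2 N. rather_below N (part1 N) x y}" "y = \<Squnion>\<^bsub>N\<^esub>A"
        using N y unfolding regular_biframe_def by blast
      then show thesis using that[of "part1 N" A] c by blast
    qed
    note PA = this
    show ?thesis
      using dense_cancel_part[OF h g1 g2 eq PA(1) yc PA(2,3)]
        dense_cancel_part[OF h g2 g1 eq[symmetric] PA(1) yc PA(2,3)] by simp
  qed
  then have "g1 y = g2 y" if "y \<in> part1 N \<union> part2 N" for y
    using that c frame_homD(3)[OF g1] frame_homD(3)[OF g2] by (intro K.le_antisym) auto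
  then show ?thesis by (rule frame_hom_eq_on_biframe[OF bN g1 g2 _ x])
qed

lemma (in frame) subframeD:
  assumes "subframe S L"
  shows "S \<subseteq> carrier L" "\<top> \<in> S" "\<bottom> \<in> S"
    and "x \<in> S \<Longrightarrow> y \<in> S \<Longrightarrow> x \<sqinter> y \<in> S" "x \<in> S \<Longrightarrow> y \<in> S \<Longrightarrow> x \<squnion> y \<in> S"
    and "A \<subseteq> S \<Longrightarrow> \<Squnion>A \<in> S"
proof -
  note s = assms[unfolded subframe_def]
  show "S \<subseteq> carrier L" "\<top> \<in> S" "x \<in> S \<Longrightarrow> y \<in> S \<Longrightarrow> x \<sqinter> y \<in> S" "A \<subseteq> S \<Longrightarrow> \<Squnion>A \<in> S"
    using s by auto
  show "\<bottom> \<in> S" using s sup_empty by (metis empty_subsetI)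
  show "x \<in> S \<Longrightarrow> y \<in> S \<Longrightarrow> x \<squnion> y \<in> S" using s by (simp add: join_def)
qed

section \<open>Lifting a lattice homomorphism on the first part\<close>

text \<open>A homomorphism from \<open>N\<close> to the biframe of frame congruences restricts on first parts to such a
  map \<open>u\<close>. The lift of the homomorphism is constructed from \<open>u\<close>.\<close>

locale first_part_hom = frame L + N: frame N
  for L :: "('a, 'm) gorder_scheme" (structure) and N :: "('c, 'k) biframe_scheme" +
  fixes u :: "'c \<Rightarrow> 'a"
  assumes N_compact: "compact_biframe N"
    and N_regular: "regular_biframe N"
    and u_closed [simp]: "x \<in> part1 N \<Longrightarrow> u x \<in> carrier L"
    and u_bottom: "u \<bottom>\<^bsub>N\<^esub> = \<bottom>"
    and u_top: "u \<top>\<^bsub>N\<^esub> = \<top>"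
    and u_meet: "x \<in> part1 N \<Longrightarrow> y \<in> part1 N \<Longrightarrow> u (x \<sqinter>\<^bsub>N\<^esub> y) = u x \<sqinter> u y"
    and u_join: "x \<in> part1 N \<Longrightarrow> y \<in> part1 N \<Longrightarrow> u (x \<squnion>\<^bsub>N\<^esub> y) = u x \<squnion> u y"
begin

lemma N_biframe: "biframe N"
  using N_regular by (simp add: regular_biframe_def)

lemma part1_subframe: "subframe (part1 N) N" and part2_subframe: "subframe (part2 N) N"
  using N_biframe by (simp_all add: biframe_def)

lemmas part1D = N.subframeD[OF part1_subframe]
lemmas part2D = N.subframeD[OF part2_subframe]

lemma part1_closed [simp]: "x \<in> part1 N \<Longrightarrow> x \<in> carrier N"
  and part2_closed [simp]: "x \<in> part2 N \<Longrightarrow> x \<in> carrier N"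
  using part1D(1) part2D(1) by auto

lemma u_mono:
  assumes "x \<in> part1 N" "y \<in> part1 N" "x \<sqsubseteq>\<^bsub>N\<^esub> y" shows "u x \<sqsubseteq> u y"
proof -
  have "u x = u x \<sqinter> u y" using u_meet[OF assms(1,2)] assms N.meet_absorb1 by simp
  then show ?thesis using assms le_iff_join by simp
qed

text \<open>A prime filter \<open>P\<close> of \<open>L\<close> determines a prime element \<open>point P\<close> of \<open>N\<close>. It is the join of two ideals,
  one in each part; \<open>out2\<close> is phrased with an element of the first part since \<open>u\<close> is defined only
  there.\<close>

definition out1 :: "'a set \<Rightarrow> 'c set" where
  "out1 P = {w \<in> part1 N. u w \<notin> P}"

definition out2 :: "'a set \<Rightarrow> 'c set" where
  "out2 P = {y \<in> part2 N. \<exists>t\<in>part1 N. t \<sqinter>\<^bsub>N\<^esub> y = \<bottom>\<^bsub>N\<^esub> \<and> u t \<in> P}"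

definition point :: "'a set \<Rightarrow> 'c" where
  "point P = \<Squnion>\<^bsub>N\<^esub>(out1 P \<union> out2 P)"

lemma out_closed: "out1 P \<union> out2 P \<subseteq> carrier N"
  by (auto simp: out1_def out2_def)

lemma point_closed [simp]: "point P \<in> carrier N"
  unfolding point_def using out_closed by (rule N.sup_closed)

lemma out_le_point: "x \<in> out1 P \<union> out2 P \<Longrightarrow> x \<sqsubseteq>\<^bsub>N\<^esub> point P"
  unfolding point_def using out_closed by (rule N.sup_upper)

lemma out1_join:
  assumes P: "prime_filter P" and "x \<in> out1 P" "y \<in> out1 P" shows "x \<squnion>\<^bsub>N\<^esub> y \<in> out1 P"
  using assms(2,3) prime_filterD(5)[OF P] by (simp add: out1_def part1D u_join)

lemma out2_join:
  assumes P: "prime_filter P" and x: "x \<in> out2 P" and y: "y \<in> out2 P"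
  shows "x \<squnion>\<^bsub>N\<^esub> y \<in> out2 P"
proof -
  obtain s t where s: "s \<in> part1 N" "s \<sqinter>\<^bsub>N\<^esub> x = \<bottom>\<^bsub>N\<^esub>" "u s \<in> P"
    and t: "t \<in> part1 N" "t \<sqinter>\<^bsub>N\<^esub> y = \<bottom>\<^bsub>N\<^esub>" "u t \<in> P" using x y by (auto simp: out2_def)
  have c: "x \<in> part2 N" "y \<in> part2 N" using x y by (auto simp: out2_def)
  have "(s \<sqinter>\<^bsub>N\<^esub> t) \<sqinter>\<^bsub>N\<^esub> x = t \<sqinter>\<^bsub>N\<^esub> (s \<sqinter>\<^bsub>N\<^esub> x)"
    by (rule HOL.trans[OF N.meet_assoc N.meet_left_comm]) (use s(1) t(1) c in simp_all)
  then have 1: "(s \<sqinter>\<^bsub>N\<^esub> t) \<sqinter>\<^bsub>N\<^esub> x = \<bottom>\<^bsub>N\<^esub>" using s t by simp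
  have "(s \<sqinter>\<^bsub>N\<^esub> t) \<sqinter>\<^bsub>N\<^esub> y = s \<sqinter>\<^bsub>N\<^esub> (t \<sqinter>\<^bsub>N\<^esub> y)"
    by (rule N.meet_assoc) (use s(1) t(1) c in simp_all)
  then have 2: "(s \<sqinter>\<^bsub>N\<^esub> t) \<sqinter>\<^bsub>N\<^esub> y = \<bottom>\<^bsub>N\<^esub>" using s t by simp
  have "(s \<sqinter>\<^bsub>N\<^esub> t) \<sqinter>\<^bsub>N\<^esub> (x \<squnion>\<^bsub>N\<^esub> y) = \<bottom>\<^bsub>N\<^esub>"
    using N.meet_join_distrib[of "s \<sqinter>\<^bsub>N\<^esub> t" x y] s t c 1 2 by simp
  moreover have "s \<sqinter>\<^bsub>N\<^esub> t \<in> part1 N" using s t part1D by blast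
  moreover have "u (s \<sqinter>\<^bsub>N\<^esub> t) \<in> P" using s t u_meet prime_filterD(4)[OF P] by simp
  ultimately show ?thesis using c part2D unfolding out2_def by blast
qed

lemma finite_out_bound:
  assumes P: "prime_filter P" and "finite F" "F \<subseteq> out1 P \<union> out2 P"
  shows "\<exists>w\<in>out1 P. \<exists>y\<in>out2 P. \<forall>x\<in>F. x \<sqsubseteq>\<^bsub>N\<^esub> w \<squnion>\<^bsub>N\<^esub> y"
  using assms(2,3)
proof (induction F)
  case empty
  have "\<bottom>\<^bsub>N\<^esub> \<in> out1 P" using part1D prime_filterD(3)[OF P] u_bottom by (simp add: out1_def)
  moreover have "\<bottom>\<^bsub>N\<^esub> \<in> out2 P"
    using part1D part2D prime_filterD(2)[OF P] u_top by (auto simp: out2_def intro!: bexI[of _ "\<top>\<^bsub>N\<^esub>"])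
  ultimately show ?case by blast
next
  case (insert a F)
  then obtain w y where w: "w \<in> out1 P" "y \<in> out2 P" "\<forall>x\<in>F. x \<sqsubseteq>\<^bsub>N\<^esub> w \<squnion>\<^bsub>N\<^esub> y" by auto
  have c: "w \<in> carrier N" "y \<in> carrier N" "a \<in> carrier N" "F \<subseteq> carrier N"
    using w insert.prems out_closed[of P] by blast+
  obtain w' y' where w': "w' \<in> out1 P" "y' \<in> out2 P" "a \<squnion>\<^bsub>N\<^esub> (w \<squnion>\<^bsub>N\<^esub> y) = w' \<squnion>\<^bsub>N\<^esub> y'"
  proof (cases "a \<in> out1 P")
    case True
    have "a \<squnion>\<^bsub>N\<^esub> (w \<squnion>\<^bsub>N\<^esub> y) = (a \<squnion>\<^bsub>N\<^esub> w) \<squnion>\<^bsub>N\<^esub> y"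
      using c by (simp add: N.join_assoc)
    then show thesis by (rule that[OF out1_join[OF P True w(1)] w(2)])
  next
    case False
    then have a: "a \<in> out2 P" using insert.prems by auto
    have "a \<squnion>\<^bsub>N\<^esub> (w \<squnion>\<^bsub>N\<^esub> y) = w \<squnion>\<^bsub>N\<^esub> (a \<squnion>\<^bsub>N\<^esub> y)"
      using c by (intro N.join_left_comm) auto
    then show thesis by (rule that[OF w(1) out2_join[OF P a w(2)]])
  qed
  have "x \<sqsubseteq>\<^bsub>N\<^esub> w' \<squnion>\<^bsub>N\<^esub> y'" if x: "x \<in> insert a F" for x
  proof (cases "x = a")
    case True
    show ?thesis unfolding True w'(3)[symmetric] using c by (intro N.join_left) auto
  next
    case False
    then have x: "x \<in> F" "x \<in> carrier N" using x c by auto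
    have le: "w \<squnion>\<^bsub>N\<^esub> y \<sqsubseteq>\<^bsub>N\<^esub> a \<squnion>\<^bsub>N\<^esub> (w \<squnion>\<^bsub>N\<^esub> y)" using c by (intro N.join_right) auto
    show ?thesis unfolding w'(3)[symmetric]
      by (rule N.le_trans[OF w(3)[rule_format, OF x(1)] le]) (use c x in auto)
  qed
  then show ?case using w' by blast
qed

text \<open>If \<open>point P\<close> were the top, compactness would give \<open>w\<close> and \<open>y\<close> in the two ideals with
  \<open>w \<squnion> y = \<top>\<close>. The \<open>t\<close> that excludes \<open>y\<close> would then lie below \<open>w\<close>, contradicting \<open>u w \<notin> P\<close>.\<close>

lemma point_proper:
  assumes P: "prime_filter P" shows "point P \<noteq> \<top>\<^bsub>N\<^esub>"
proof
  assume top: "point P = \<top>\<^bsub>N\<^esub>"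
  have "\<forall>A\<subseteq>carrier N. \<Squnion>\<^bsub>N\<^esub>A = \<top>\<^bsub>N\<^esub> \<longrightarrow> (\<exists>F\<subseteq>A. finite F \<and> \<Squnion>\<^bsub>N\<^esub>F = \<top>\<^bsub>N\<^esub>)"
    using N_compact by (simp add: compact_biframe_def compact_frame_def)
  from this[rule_format, OF out_closed top[unfolded point_def]]
  obtain F where F: "F \<subseteq> out1 P \<union> out2 P" "finite F" "\<Squnion>\<^bsub>N\<^esub>F = \<top>\<^bsub>N\<^esub>" by blast
  obtain w y where w: "w \<in> out1 P" "y \<in> out2 P" "\<forall>x\<in>F. x \<sqsubseteq>\<^bsub>N\<^esub> w \<squnion>\<^bsub>N\<^esub> y"
    using finite_out_bound[OF P F(2,1)] by blast
  obtain t where t: "t \<in> part1 N" "t \<sqinter>\<^bsub>N\<^esub> y = \<bottom>\<^bsub>N\<^esub>" "u t \<in> P" using w(2) by (auto simp: out2_def)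
  have c: "w \<in> part1 N" "y \<in> part2 N" using w by (auto simp: out1_def out2_def)
  have "\<Squnion>\<^bsub>N\<^esub>F \<sqsubseteq>\<^bsub>N\<^esub> w \<squnion>\<^bsub>N\<^esub> y"
    using subset_trans[OF F(1) out_closed] c w(3) by (intro N.sup_least) auto
  then have "w \<squnion>\<^bsub>N\<^esub> y = \<top>\<^bsub>N\<^esub>" using F(3) N.top_le_iff c by simp
  then have "t \<sqsubseteq>\<^bsub>N\<^esub> w" using t c by (intro N.cover_le[of t w y]) auto
  then have "u t \<sqsubseteq> u w" using t c u_mono by blast
  then have "u w \<in> P" using prime_filter_mono[OF P t(3)] c by simp
  then show False using w(1) by (simp add: out1_def)
qed

text \<open>The conditions for an element of the first or second part not to lie below \<open>point P\<close>. They
  exhibit an element of one of the two ideals whose join with the given element is the top.\<close>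

definition in1 :: "'a set \<Rightarrow> 'c \<Rightarrow> bool" where
  "in1 P x \<longleftrightarrow> (\<exists>w\<in>part1 N. rather_below N (part2 N) w x \<and> u w \<in> P)"

definition in2 :: "'a set \<Rightarrow> 'c \<Rightarrow> bool" where
  "in2 P y \<longleftrightarrow> (\<exists>t\<in>part1 N. t \<squnion>\<^bsub>N\<^esub> y = \<top>\<^bsub>N\<^esub> \<and> u t \<notin> P)"

lemma join_point_top:
  assumes "z \<in> out1 P \<union> out2 P" "x \<in> carrier N" "x \<squnion>\<^bsub>N\<^esub> z = \<top>\<^bsub>N\<^esub>"
  shows "x \<squnion>\<^bsub>N\<^esub> point P = \<top>\<^bsub>N\<^esub>"
proof -
  have z: "z \<in> carrier N" using assms(1) out_closed by auto
  have "z \<sqsubseteq>\<^bsub>N\<^esub> x \<squnion>\<^bsub>N\<^esub> point P"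
    by (rule N.le_trans[OF out_le_point[OF assms(1)] N.join_right]) (use assms z in auto)
  moreover have "x \<sqsubseteq>\<^bsub>N\<^esub> x \<squnion>\<^bsub>N\<^esub> point P" using assms by (intro N.join_left) auto
  ultimately have "x \<squnion>\<^bsub>N\<^esub> z \<sqsubseteq>\<^bsub>N\<^esub> x \<squnion>\<^bsub>N\<^esub> point P" using assms z by (intro N.join_le) auto
  then show ?thesis using assms by (simp add: N.top_le_iff)
qed

lemma in1_join_point:
  assumes "x \<in> part1 N" "in1 P x" shows "x \<squnion>\<^bsub>N\<^esub> point P = \<top>\<^bsub>N\<^esub>"
proof -
  obtain w z where "w \<in> part1 N" "z \<in> part2 N" "w \<sqinter>\<^bsub>N\<^esub> z = \<bottom>\<^bsub>N\<^esub>" "x \<squnion>\<^bsub>N\<^esub> z = \<top>\<^bsub>N\<^esub>" "u w \<in> P"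
    using assms(2) unfolding in1_def rather_below_def by blast
  then show ?thesis
    using assms(1) by (intro join_point_top[of z]) (auto simp: out2_def)
qed

lemma in2_join_point:
  assumes "y \<in> part2 N" "in2 P y" shows "y \<squnion>\<^bsub>N\<^esub> point P = \<top>\<^bsub>N\<^esub>"
proof -
  obtain t where "t \<in> part1 N" "y \<squnion>\<^bsub>N\<^esub> t = \<top>\<^bsub>N\<^esub>" "u t \<notin> P"
    using assms(2) join_comm[of N] unfolding in2_def by metis
  then show ?thesis
    using assms(1) by (intro join_point_top[of t]) (auto simp: out1_def)
qed

lemma sup_not_le:
  assumes "A \<subseteq> carrier N" "q \<in> carrier N" "\<not> \<Squnion>\<^bsub>N\<^esub>A \<sqsubseteq>\<^bsub>N\<^esub> q"
  obtains a where "a \<in> A" "\<not> a \<sqsubseteq>\<^bsub>N\<^esub> q"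
  using N.sup_least[OF assms(1,2)] assms(3) by blast

lemma not_le_point_in1:
  assumes x: "x \<in> part1 N" and le: "\<not> x \<sqsubseteq>\<^bsub>N\<^esub> point P" shows "in1 P x"
proof -
  obtain A where A: "A \<subseteq> {w \<in> part1 N. rather_below N (part2 N) w x}" "x = \<Squnion>\<^bsub>N\<^esub>A"
    using N_regular x unfolding regular_biframe_def by blast
  have "A \<subseteq> carrier N" using A by auto
  then obtain w where w: "w \<in> A" "\<not> w \<sqsubseteq>\<^bsub>N\<^esub> point P"
    using sup_not_le[of A "point P"] le A(2) by auto
  then have "w \<notin> out1 P" using out_le_point by blast
  then show ?thesis using w A by (auto simp: in1_def out1_def)
qed

lemma not_le_point_in2:
  assumes y: "y \<in> part2 N" and le: "\<not> y \<sqsubseteq>\<^bsub>N\<^esub> point P" shows "in2 P y"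
proof -
  obtain A where A: "A \<subseteq> {v \<in> part2 N. rather_below N (part1 N) v y}" "y = \<Squnion>\<^bsub>N\<^esub>A"
    using N_regular y unfolding regular_biframe_def by blast
  have "A \<subseteq> carrier N" using A by auto
  then obtain v where v: "v \<in> A" "\<not> v \<sqsubseteq>\<^bsub>N\<^esub> point P"
    using sup_not_le[of A "point P"] le A(2) by auto
  then obtain t where t: "t \<in> part1 N" "v \<sqinter>\<^bsub>N\<^esub> t = \<bottom>\<^bsub>N\<^esub>" "y \<squnion>\<^bsub>N\<^esub> t = \<top>\<^bsub>N\<^esub>"
    using A unfolding rather_below_def by blast
  have "v \<notin> out2 P" using v out_le_point by blast
  moreover have "v \<in> part2 N" using v A by auto
  moreover have "t \<sqinter>\<^bsub>N\<^esub> v = \<bottom>\<^bsub>N\<^esub>" using t(2) meet_comm[of N t v] by simp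
  ultimately have "u t \<notin> P" using t(1) unfolding out2_def by blast
  moreover have "t \<squnion>\<^bsub>N\<^esub> y = \<top>\<^bsub>N\<^esub>" using t(3) join_comm[of N t y] by simp
  ultimately show ?thesis using t(1) unfolding in2_def by blast
qed

lemma N_base:
  assumes n: "n \<in> carrier N"
  shows "\<exists>A. A \<subseteq> {x \<sqinter>\<^bsub>N\<^esub> y |x y. x \<in> part1 N \<and> y \<in> part2 N} \<and> n = \<Squnion>\<^bsub>N\<^esub>A"
proof -
  let ?B = "{x \<sqinter>\<^bsub>N\<^esub> y |x y. x \<in> part1 N \<and> y \<in> part2 N}"
  have B: "?B \<subseteq> carrier N" by auto
  have BI: "x \<sqinter>\<^bsub>N\<^esub> y \<in> ?B" if "x \<in> part1 N" "y \<in> part2 N" for x y using that by blast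
  have eq: "subframe_generated N ?B = {\<Squnion>\<^bsub>N\<^esub>A |A. A \<subseteq> ?B}"
  proof (rule N.subframe_generated_base[OF B])
    show "\<top>\<^bsub>N\<^esub> \<in> ?B" using BI[OF part1D(2) part2D(2)] by simp
    fix a b assume "a \<in> ?B" "b \<in> ?B"
    then obtain x y x' y' where x: "a = x \<sqinter>\<^bsub>N\<^esub> y" "x \<in> part1 N" "y \<in> part2 N"
      and x': "b = x' \<sqinter>\<^bsub>N\<^esub> y'" "x' \<in> part1 N" "y' \<in> part2 N" by blast
    have "a \<sqinter>\<^bsub>N\<^esub> b = (x \<sqinter>\<^bsub>N\<^esub> x') \<sqinter>\<^bsub>N\<^esub> (y \<sqinter>\<^bsub>N\<^esub> y')"
      using x x' by (simp add: N.meet_assoc N.meet_left_comm[of y x'])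
    then show "a \<sqinter>\<^bsub>N\<^esub> b \<in> ?B"
      using BI[OF part1D(4)[OF x(2) x'(2)] part2D(4)[OF x(3) x'(3)]] by simp
  qed
  have "x \<in> ?B" if "x \<in> part1 N \<union> part2 N" for x
    using that
  proof
    assume x: "x \<in> part1 N"
    then show ?thesis using BI[OF x part2D(2)] by simp
  next
    assume x: "x \<in> part2 N"
    then show ?thesis using BI[OF part1D(2) x] by simp
  qed
  then have "part1 N \<union> part2 N \<subseteq> ?B" by (rule subsetI)
  then have "part1 N \<union> part2 N \<subseteq> subframe_generated N ?B"
    using N.subset_subframe_generated by blast
  then have "subframe_generated N (part1 N \<union> part2 N) \<subseteq> subframe_generated N ?B"
    by (rule N.subframe_generated_least[OF N.subframe_subframe_generated[OF B]])
  then have "carrier N \<subseteq> subframe_generated N ?B"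
    using N_biframe by (simp add: biframe_def)
  then show ?thesis using n eq by blast
qed

lemma not_le_point:
  assumes n: "n \<in> carrier N" and le: "\<not> n \<sqsubseteq>\<^bsub>N\<^esub> point P"
  obtains x y where "x \<in> part1 N" "y \<in> part2 N" "x \<sqinter>\<^bsub>N\<^esub> y \<sqsubseteq>\<^bsub>N\<^esub> n" "in1 P x" "in2 P y"
proof -
  obtain A where A: "A \<subseteq> {x \<sqinter>\<^bsub>N\<^esub> y |x y. x \<in> part1 N \<and> y \<in> part2 N}" "n = \<Squnion>\<^bsub>N\<^esub>A"
    using N_base[OF n] by blast
  have Ac: "A \<subseteq> carrier N" using A by auto
  then obtain a where a: "a \<in> A" "\<not> a \<sqsubseteq>\<^bsub>N\<^esub> point P"
    using sup_not_le[of A "point P"] le A(2) by auto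
  then obtain x y where x: "a = x \<sqinter>\<^bsub>N\<^esub> y" "x \<in> part1 N" "y \<in> part2 N" using A(1) by blast
  have "\<not> x \<sqsubseteq>\<^bsub>N\<^esub> point P"
    using N.le_trans[OF N.meet_left[of x y], of "point P"] a x by auto
  moreover have "\<not> y \<sqsubseteq>\<^bsub>N\<^esub> point P"
    using N.le_trans[OF N.meet_right[of x y], of "point P"] a x by auto
  moreover have "x \<sqinter>\<^bsub>N\<^esub> y \<sqsubseteq>\<^bsub>N\<^esub> n" using N.sup_upper[OF Ac a(1)] A(2) x by simp
  ultimately show thesis using that x not_le_point_in1 not_le_point_in2 by blast
qed

text \<open>An element not below \<open>point P\<close> joins with it to the top, so \<open>point P\<close> is even a maximal element, and
  in particular prime.\<close>

lemma in_join_point: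
  assumes n: "n \<in> carrier N" and x: "x \<in> part1 N" "in1 P x" and y: "y \<in> part2 N" "in2 P y"
    and le: "x \<sqinter>\<^bsub>N\<^esub> y \<sqsubseteq>\<^bsub>N\<^esub> n"
  shows "n \<squnion>\<^bsub>N\<^esub> point P = \<top>\<^bsub>N\<^esub>"
proof -
  have "point P \<squnion>\<^bsub>N\<^esub> (x \<sqinter>\<^bsub>N\<^esub> y) = (point P \<squnion>\<^bsub>N\<^esub> x) \<sqinter>\<^bsub>N\<^esub> (point P \<squnion>\<^bsub>N\<^esub> y)"
    using x y by (intro N.join_meet_distrib) auto
  also have "\<dots> = \<top>\<^bsub>N\<^esub>"
    using in1_join_point[OF x] in2_join_point[OF y] by (simp add: join_comm[of N "point P"])
  finally have top: "point P \<squnion>\<^bsub>N\<^esub> (x \<sqinter>\<^bsub>N\<^esub> y) = \<top>\<^bsub>N\<^esub>" .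
  have "x \<sqinter>\<^bsub>N\<^esub> y \<sqsubseteq>\<^bsub>N\<^esub> n \<squnion>\<^bsub>N\<^esub> point P"
    by (rule N.le_trans[OF le N.join_left]) (use n x y in auto)
  moreover have "point P \<sqsubseteq>\<^bsub>N\<^esub> n \<squnion>\<^bsub>N\<^esub> point P" using n by (intro N.join_right) auto
  ultimately have "point P \<squnion>\<^bsub>N\<^esub> (x \<sqinter>\<^bsub>N\<^esub> y) \<sqsubseteq>\<^bsub>N\<^esub> n \<squnion>\<^bsub>N\<^esub> point P"
    using n x y by (intro N.join_le) auto
  then show ?thesis using top n by (simp add: N.top_le_iff)
qed

lemma join_point_not_le:
  assumes P: "prime_filter P" and n: "n \<in> carrier N" "n \<squnion>\<^bsub>N\<^esub> point P = \<top>\<^bsub>N\<^esub>"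
  shows "\<not> n \<sqsubseteq>\<^bsub>N\<^esub> point P"
  using point_proper[OF P] n N.join_absorb1[of n "point P"] by auto

lemma meet_le_point_iff:
  assumes P: "prime_filter P" and n: "n \<in> carrier N" and m: "m \<in> carrier N"
  shows "n \<sqinter>\<^bsub>N\<^esub> m \<sqsubseteq>\<^bsub>N\<^esub> point P \<longleftrightarrow> n \<sqsubseteq>\<^bsub>N\<^esub> point P \<or> m \<sqsubseteq>\<^bsub>N\<^esub> point P"
proof
  assume "n \<sqsubseteq>\<^bsub>N\<^esub> point P \<or> m \<sqsubseteq>\<^bsub>N\<^esub> point P"
  then show "n \<sqinter>\<^bsub>N\<^esub> m \<sqsubseteq>\<^bsub>N\<^esub> point P"
    using N.le_trans[OF N.meet_left[OF n m], of "point P"]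
      N.le_trans[OF N.meet_right[OF n m], of "point P"] n m by auto
next
  assume nm: "n \<sqinter>\<^bsub>N\<^esub> m \<sqsubseteq>\<^bsub>N\<^esub> point P"
  have top: "k \<squnion>\<^bsub>N\<^esub> point P = \<top>\<^bsub>N\<^esub>" if k: "k \<in> carrier N" "\<not> k \<sqsubseteq>\<^bsub>N\<^esub> point P" for k
  proof -
    obtain x y where "x \<in> part1 N" "y \<in> part2 N" "x \<sqinter>\<^bsub>N\<^esub> y \<sqsubseteq>\<^bsub>N\<^esub> k" "in1 P x" "in2 P y"
      by (rule not_le_point[OF k])
    then show ?thesis by (intro in_join_point[OF k(1), of x P y])
  qed
  show "n \<sqsubseteq>\<^bsub>N\<^esub> point P \<or> m \<sqsubseteq>\<^bsub>N\<^esub> point P"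
  proof (rule ccontr)
    assume "\<not> ?thesis"
    then have "n \<squnion>\<^bsub>N\<^esub> point P = \<top>\<^bsub>N\<^esub>" "m \<squnion>\<^bsub>N\<^esub> point P = \<top>\<^bsub>N\<^esub>" using top n m by auto
    then have "(n \<sqinter>\<^bsub>N\<^esub> m) \<squnion>\<^bsub>N\<^esub> point P = \<top>\<^bsub>N\<^esub>"
      using N.join_meet_distrib[of "point P" n m] n m by (simp add: join_comm[of N _ "point P"])
    then show False using join_point_not_le[OF P] nm n m by simp
  qed
qed

text \<open>The condition on \<open>P\<close> describes a closed set of prime filters; its complement is the preimage of the
  open set \<open>n\<close> under \<open>point\<close>.\<close>

definition lift :: "'c \<Rightarrow> ('a \<times> 'a) set" where
  "lift n = {(a, b) \<in> carrier L \<times> carrier L.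
     \<forall>P. prime_filter P \<longrightarrow> n \<sqsubseteq>\<^bsub>N\<^esub> point P \<longrightarrow> (a, b) \<in> ker P}"

lemma liftD: "(a, b) \<in> lift n \<Longrightarrow> prime_filter P \<Longrightarrow> n \<sqsubseteq>\<^bsub>N\<^esub> point P \<Longrightarrow> (a, b) \<in> ker P"
  by (simp add: lift_def)

lemma lift_congruence: "lattice_congruence L (lift n)"
proof -
  let ?S = "insert (carrier L \<times> carrier L) {ker P |P. prime_filter P \<and> n \<sqsubseteq>\<^bsub>N\<^esub> point P}"
  have "lattice_congruence L (\<Inter>?S)"
    by (rule lattice_congruence_Inter)
      (use lattice_congruence_ker frame_congruence_lattice[OF frame_congruence_full] in auto)
  also have "\<Inter>?S = lift n" by (auto simp: lift_def)
  finally show ?thesis .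
qed

lemma lift_in_LC: "lift n \<in> {\<theta>. lattice_congruence L \<theta>}"
  using lift_congruence by simp

text \<open>Separation reduces an upper bound for \<open>lift n\<close> to a statement about single prime filters.\<close>

lemma lift_subsetI:
  assumes C: "lattice_congruence L C"
    and P: "\<And>P. prime_filter P \<Longrightarrow> C \<subseteq> ker P \<Longrightarrow> n \<sqsubseteq>\<^bsub>N\<^esub> point P"
  shows "lift n \<subseteq> C"
proof clarify
  fix a b assume ab: "(a, b) \<in> lift n"
  then have c: "a \<in> carrier L" "b \<in> carrier L" by (auto simp: lift_def)
  show "(a, b) \<in> C"
  proof (rule ccontr)
    assume "(a, b) \<notin> C"
    then obtain P where "prime_filter P" "C \<subseteq> ker P" "(a, b) \<notin> ker P"
      by (rule lattice_congruence_separation[OF C c])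
    then show False using liftD[OF ab] P by blast
  qed
qed

lemma lift_top: "lift \<top>\<^bsub>N\<^esub> = carrier L \<times> carrier L"
  using point_proper by (auto simp: lift_def N.top_le_iff)

lemma lift_meet:
  assumes "n \<in> carrier N" "m \<in> carrier N" shows "lift (n \<sqinter>\<^bsub>N\<^esub> m) = lift n \<inter> lift m"
  using meet_le_point_iff[OF _ assms] by (auto simp: lift_def)

text \<open>It remains to see that a prime filter whose kernel contains every \<open>lift s\<close> has all \<open>s\<close> below its
  point. Otherwise the witnesses for some \<open>s\<close> yield a pair in \<open>lift s\<close> that the filter separates.\<close>

lemma lift_sup:
  assumes S: "S \<subseteq> carrier N"
  shows "lift (\<Squnion>\<^bsub>N\<^esub>S) = lattice_congruence_generated L (\<Union>(lift ` S))"
proof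
  have g: "lattice_congruence L (lattice_congruence_generated L (\<Union>(lift ` S)))"
    using lat.gen_Union_in[of "lift ` S"] lift_congruence by blast
  show "lattice_congruence_generated L (\<Union>(lift ` S)) \<subseteq> lift (\<Squnion>\<^bsub>N\<^esub>S)"
  proof (rule lat.gen_least[OF lift_in_LC], rule UN_least)
    fix s assume s: "s \<in> S"
    have "s \<sqsubseteq>\<^bsub>N\<^esub> point P" if "\<Squnion>\<^bsub>N\<^esub>S \<sqsubseteq>\<^bsub>N\<^esub> point P" for P
      by (rule N.le_trans[OF N.sup_upper[OF S s] that]) (use s S in auto)
    then show "lift s \<subseteq> lift (\<Squnion>\<^bsub>N\<^esub>S)" by (auto simp: lift_def)
  qed
  show "lift (\<Squnion>\<^bsub>N\<^esub>S) \<subseteq> lattice_congruence_generated L (\<Union>(lift ` S))"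
  proof (rule lift_subsetI[OF g], rule ccontr)
    fix P assume P: "prime_filter P" and le: "lattice_congruence_generated L (\<Union>(lift ` S)) \<subseteq> ker P"
      and "\<not> \<Squnion>\<^bsub>N\<^esub>S \<sqsubseteq>\<^bsub>N\<^esub> point P"
    then obtain s where s: "s \<in> S" "\<not> s \<sqsubseteq>\<^bsub>N\<^esub> point P" using sup_not_le[OF S point_closed] by blast
    then have sc: "s \<in> carrier N" using S by auto
    obtain x y where xy: "x \<in> part1 N" "y \<in> part2 N" "x \<sqinter>\<^bsub>N\<^esub> y \<sqsubseteq>\<^bsub>N\<^esub> s" "in1 P x" "in2 P y"
      by (rule not_le_point[OF sc s(2)])
    obtain w where w: "w \<in> part1 N" "rather_below N (part2 N) w x" "u w \<in> P"
      using xy(4) unfolding in1_def by blast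
    obtain t where t: "t \<in> part1 N" "t \<squnion>\<^bsub>N\<^esub> y = \<top>\<^bsub>N\<^esub>" "u t \<notin> P"
      using xy(5) unfolding in2_def by blast
    \<comment> \<open>The pair \<open>(u t, u t \<squnion> u w)\<close> is separated exactly by the prime filters that contain \<open>u w\<close> and
      omit \<open>u t\<close>. Each of these has \<open>x \<sqinter> y\<close>, and hence \<open>s\<close>, not below its point, and \<open>P\<close> is one of
      them.\<close>
    have "(u t, u t \<squnion> u w) \<in> ker Q" if Q: "prime_filter Q" and sQ: "s \<sqsubseteq>\<^bsub>N\<^esub> point Q" for Q
    proof -
      have "\<not> (in1 Q x \<and> in2 Q y)"
        using in_join_point[OF sc xy(1) _ xy(2) _ xy(3)] join_point_not_le[OF Q sc] sQ by blast
      then have "u w \<notin> Q \<or> u t \<in> Q" using w t unfolding in1_def in2_def by blast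
      then show ?thesis using prime_filterD(5)[OF Q] w(1) t(1) by (auto simp: ker_def)
    qed
    then have "(u t, u t \<squnion> u w) \<in> lift s" using w(1) t(1) by (simp add: lift_def)
    then have "(u t, u t \<squnion> u w) \<in> ker P" using le lat.gen_upper[of "\<Union>(lift ` S)"] s(1) by blast
    then show False using prime_filterD(5)[OF P] w(1,3) t(1,3) by (simp add: ker_def)
  qed
qed

lemma lift_part1:
  assumes x: "x \<in> part1 N"
  shows "lift x = lattice_congruence_generated L
    (\<Union>a\<in>u ` {w \<in> part1 N. rather_below N (part2 N) w x}. nabla L a)" (is "_ = ?g (\<Union>a\<in>?A. _)")
proof
  have A: "?A \<subseteq> carrier L" by auto
  have g: "lattice_congruence L (?g (\<Union>a\<in>?A. nabla L a))"
    using lat.gen_Union_in[of "nabla L ` ?A"] lattice_congruence_nabla A by blast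
  show "?g (\<Union>a\<in>?A. nabla L a) \<subseteq> lift x"
  proof (rule lat.gen_least[OF lift_in_LC], rule UN_least)
    fix a assume "a \<in> ?A"
    then obtain w where w: "w \<in> part1 N" "rather_below N (part2 N) w x" "a = u w" by blast
    have "(\<bottom>, u w) \<in> ker P" if P: "prime_filter P" and xP: "x \<sqsubseteq>\<^bsub>N\<^esub> point P" for P
    proof -
      have "\<not> in1 P x"
        using in1_join_point[OF x] join_point_not_le[OF P part1_closed[OF x]] xP by blast
      then have "u w \<notin> P" using w unfolding in1_def by blast
      then show ?thesis using prime_filterD(3)[OF P] w by (simp add: ker_def)
    qed
    then have "(\<bottom>, u w) \<in> lift x" using w by (simp add: lift_def)
    then show "nabla L a \<subseteq> lift x" using nabla_subset_iff[OF lift_congruence] w by simp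
  qed
  show "lift x \<subseteq> ?g (\<Union>a\<in>?A. nabla L a)"
  proof (rule lift_subsetI[OF g], rule ccontr)
    fix P assume P: "prime_filter P" and le: "?g (\<Union>a\<in>?A. nabla L a) \<subseteq> ker P"
      and "\<not> x \<sqsubseteq>\<^bsub>N\<^esub> point P"
    then have "in1 P x" using not_le_point_in1[OF x] by blast
    then obtain w where w: "w \<in> part1 N" "rather_below N (part2 N) w x" "u w \<in> P"
      unfolding in1_def by blast
    have "nabla L (u w) \<subseteq> ker P"
      using le lat.gen_upper[of "\<Union>a\<in>?A. nabla L a"] w(1,2) by blast
    then have "(\<bottom>, u w) \<in> ker P"
      using nabla_subset_iff[OF lattice_congruence_ker[OF P]] w(1) by simp
    then show False using prime_filterD(3)[OF P] w(3) by (simp add: ker_def)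
  qed
qed

lemma lift_part2:
  assumes y: "y \<in> part2 N"
  shows "lift y = lattice_congruence_generated L
    (\<Union>a\<in>u ` {t \<in> part1 N. t \<squnion>\<^bsub>N\<^esub> y = \<top>\<^bsub>N\<^esub>}. delta L a)" (is "_ = ?g (\<Union>a\<in>?A. _)")
proof
  have A: "?A \<subseteq> carrier L" by auto
  have g: "lattice_congruence L (?g (\<Union>a\<in>?A. delta L a))"
    using lat.gen_Union_in[of "delta L ` ?A"] lattice_congruence_delta A by blast
  show "?g (\<Union>a\<in>?A. delta L a) \<subseteq> lift y"
  proof (rule lat.gen_least[OF lift_in_LC], rule UN_least)
    fix a assume "a \<in> ?A"
    then obtain t where t: "t \<in> part1 N" "t \<squnion>\<^bsub>N\<^esub> y = \<top>\<^bsub>N\<^esub>" "a = u t" by blast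
    have "(u t, \<top>) \<in> ker P" if P: "prime_filter P" and yP: "y \<sqsubseteq>\<^bsub>N\<^esub> point P" for P
    proof -
      have "\<not> in2 P y"
        using in2_join_point[OF y] join_point_not_le[OF P part2_closed[OF y]] yP by blast
      then have "u t \<in> P" using t unfolding in2_def by blast
      then show ?thesis using prime_filterD(2)[OF P] t by (simp add: ker_def)
    qed
    then have "(u t, \<top>) \<in> lift y" using t by (simp add: lift_def)
    then show "delta L a \<subseteq> lift y" using delta_subset_iff[OF lift_congruence] t by simp
  qed
  show "lift y \<subseteq> ?g (\<Union>a\<in>?A. delta L a)"
  proof (rule lift_subsetI[OF g], rule ccontr)
    fix P assume P: "prime_filter P" and le: "?g (\<Union>a\<in>?A. delta L a) \<subseteq> ker P"
      and "\<not> y \<sqsubseteq>\<^bsub>N\<^esub> point P"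
    then have "in2 P y" using not_le_point_in2[OF y] by blast
    then obtain t where t: "t \<in> part1 N" "t \<squnion>\<^bsub>N\<^esub> y = \<top>\<^bsub>N\<^esub>" "u t \<notin> P"
      unfolding in2_def by blast
    have "delta L (u t) \<subseteq> ker P"
      using le lat.gen_upper[of "\<Union>a\<in>?A. delta L a"] t(1,2) by blast
    then have "(u t, \<top>) \<in> ker P"
      using delta_subset_iff[OF lattice_congruence_ker[OF P]] t(1) by simp
    then show False using prime_filterD(2)[OF P] t(3) by (simp add: ker_def)
  qed
qed

lemma lift_biframe_hom: "biframe_hom N LC lift"
  unfolding biframe_hom_def
proof (intro conjI N_biframe lat.biframe_B)
  show "frame_hom N LC lift"
  proof (rule frame_homI[OF N.frame_axioms lat.B_frame])
    show "lift x \<in> carrier LC" for x using lift_congruence lat.B_order by simp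
    show "lift \<top>\<^bsub>N\<^esub> = \<top>\<^bsub>LC\<^esub>" unfolding lat.B_top by (rule lift_top)
    show "lift (x \<sqinter>\<^bsub>N\<^esub> y) = lift x \<sqinter>\<^bsub>LC\<^esub> lift y" if "x \<in> carrier N" "y \<in> carrier N" for x y
      using lift_meet[OF that] lat.B_meet[OF lift_in_LC lift_in_LC] by simp
    show "lift (\<Squnion>\<^bsub>N\<^esub>A) = \<Squnion>\<^bsub>LC\<^esub>(lift ` A)" if "A \<subseteq> carrier N" for A
      using lift_sup[OF that] lat.B_sup[of "lift ` A"] lift_in_LC by auto
  qed
  show "lift ` part1 N \<subseteq> part1 LC"
    using lift_part1 unfolding lat.part1_B by (auto intro!: exI[of _ "u ` _"])
  show "lift ` part2 N \<subseteq> part2 LC"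
    using lift_part2 unfolding lat.part2_B by (auto intro!: exI[of _ "u ` _"])
qed

end

section \<open>The universal property\<close>

context frame
begin

lemma gen_nabla_sup:
  assumes A: "A \<subseteq> carrier L"
  shows "frame_congruence_generated L (\<Union>a\<in>A. nabla L a) = nabla L (\<Squnion>A)"
proof
  have s: "\<Squnion>A \<in> carrier L" using A by simp
  have gA: "nabla L ` A \<subseteq> {\<theta>. frame_congruence L \<theta>}" using frm.family_nabla A by blast
  have g: "frame_congruence L (frame_congruence_generated L (\<Union>a\<in>A. nabla L a))"
    using frm.gen_Union_in[OF gA] by simp
  show "frame_congruence_generated L (\<Union>a\<in>A. nabla L a) \<subseteq> nabla L (\<Squnion>A)"
  proof (rule frm.gen_least[OF frm.family_nabla[OF s]], rule UN_least)
    fix a assume a: "a \<in> A"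
    then show "nabla L a \<subseteq> nabla L (\<Squnion>A)"
      using nabla_subset_nabla_iff[of a "\<Squnion>A"] sup_upper[OF A a] s A by auto
  qed
  let ?R = "(\<lambda>a. (\<bottom>, a)) ` A"
  have "(\<bottom>, a) \<in> nabla L a" if "a \<in> A" for a using A that by (auto simp: nabla_def)
  then have "?R \<subseteq> (\<Union>a\<in>A. nabla L a)" by blast
  also have "\<dots> \<subseteq> frame_congruence_generated L (\<Union>a\<in>A. nabla L a)" by (rule frm.gen_upper)
  finally have "(\<Squnion>(fst ` ?R), \<Squnion>(snd ` ?R)) \<in> frame_congruence_generated L (\<Union>a\<in>A. nabla L a)"
    by (rule frame_congruence_sup[OF g])
  moreover have "\<Squnion>(fst ` ?R) = \<bottom>"
    using sup_empty by (cases "A = {}") (simp_all add: image_image image_constant_conv)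
  moreover have "snd ` ?R = A" by (simp add: image_image)
  ultimately show "nabla L (\<Squnion>A) \<subseteq> frame_congruence_generated L (\<Union>a\<in>A. nabla L a)"
    using nabla_subset_iff[OF frame_congruence_lattice[OF g] s] by simp
qed

lemma part1_FC: "part1 FC = nabla L ` carrier L"
proof
  show "part1 FC \<subseteq> nabla L ` carrier L"
    unfolding frm.part1_B using gen_nabla_sup by auto
  show "nabla L ` carrier L \<subseteq> part1 FC"
    using frm.nabla_in_part1 by auto
qed

text \<open>The lift along \<open>u\<close> composes with \<open>h\<close> to \<open>f\<close>. On the first part this compares \<open>x\<close> with the join of
  the \<open>w \<prec> x\<close>. On the second part, \<open>t \<squnion> y = \<top>\<close> gives \<open>\<Delta>\<^bsub>u t\<^esub> \<subseteq> f y\<close>, while a witness \<open>t\<close> of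
  \<open>x \<prec> y\<close> gives \<open>f x \<subseteq> \<Delta>\<^bsub>u t\<^esub>\<close>.\<close>

lemma factorization:
  fixes N :: "'c biframe"
  assumes N: "compact_biframe N" "regular_biframe N" and f: "biframe_hom N FC f"
  shows "\<exists>g. biframe_hom N LC g \<and> (\<forall>x\<in>carrier N. frame_congruence_generated L (g x) = f x)"
proof -
  let ?h = "frame_congruence_generated L"
  have ff: "frame_hom N FC f" and bN: "biframe N" using f by (simp_all add: biframe_hom_def)
  interpret N: frame N using frame_homD(1)[OF ff] .
  interpret M: frame FC by (rule frm.B_frame)
  have s1: "subframe (part1 N) N" and s2: "subframe (part2 N) N" using bN by (simp_all add: biframe_def)
  note p1 = N.subframeD[OF s1] and p2 = N.subframeD[OF s2]
  define u where "u w = (SOME a. a \<in> carrier L \<and> f w = nabla L a)" for w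
  have u: "u w \<in> carrier L \<and> f w = nabla L (u w)" if "w \<in> part1 N" for w
  proof -
    have "f w \<in> nabla L ` carrier L" using f that part1_FC by (auto simp: biframe_hom_def)
    then have "\<exists>a. a \<in> carrier L \<and> f w = nabla L a" by blast
    then show ?thesis unfolding u_def by (rule someI_ex)
  qed
  have u_eqI: "u w = a" if "w \<in> part1 N" "a \<in> carrier L" "f w = nabla L a" for w a
    using u[OF that(1)] that nabla_inj[of "u w" a] by simp
  have u_sup: "u (\<Squnion>\<^bsub>N\<^esub>A) = \<Squnion>(u ` A)" if A: "A \<subseteq> part1 N" for A
  proof (rule u_eqI[OF p1(6)[OF A]])
    have uA: "u ` A \<subseteq> carrier L" using u A by auto
    then show "\<Squnion>(u ` A) \<in> carrier L" by simp
    have Ac: "A \<subseteq> carrier N" using A p1(1) by blast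
    have fA: "f ` A = nabla L ` u ` A" using u A by (auto simp: image_image intro!: image_cong)
    have "f (\<Squnion>\<^bsub>N\<^esub>A) = \<Squnion>\<^bsub>FC\<^esub>(nabla L ` u ` A)" using frame_homD(6)[OF ff Ac] fA by simp
    also have "\<dots> = ?h (\<Union>a\<in>u ` A. nabla L a)"
      using frm.B_sup[of "nabla L ` u ` A"] frm.family_nabla uA by blast
    also have "\<dots> = nabla L (\<Squnion>(u ` A))" by (rule gen_nabla_sup[OF uA])
    finally show "f (\<Squnion>\<^bsub>N\<^esub>A) = nabla L (\<Squnion>(u ` A))" .
  qed
  have lift: "first_part_hom L N u"
  proof (intro first_part_hom.intro first_part_hom_axioms.intro frame_axioms N.frame_axioms)
    show "u x \<in> carrier L" if "x \<in> part1 N" for x using u that by blast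
    show "u \<bottom>\<^bsub>N\<^esub> = \<bottom>" using u_sup[of "{}"] by (simp add: sup_empty N.sup_empty)
    show "u \<top>\<^bsub>N\<^esub> = \<top>"
      using frame_homD(4)[OF ff] frm.B_top by (intro u_eqI p1(2)) (simp_all add: nabla_top)
    show "u (x \<squnion>\<^bsub>N\<^esub> y) = u x \<squnion> u y" if "x \<in> part1 N" "y \<in> part1 N" for x y
      using u_sup[of "{x, y}"] that by (simp add: join_def)
    show "u (x \<sqinter>\<^bsub>N\<^esub> y) = u x \<sqinter> u y" if x: "x \<in> part1 N" and y: "y \<in> part1 N" for x y
    proof (rule u_eqI[OF p1(4)[OF x y]])
      show "u x \<sqinter> u y \<in> carrier L" using u[OF x] u[OF y] by simp
      have "f (x \<sqinter>\<^bsub>N\<^esub> y) = f x \<sqinter>\<^bsub>FC\<^esub> f y" using x y p1(1) by (intro frame_homD(5)[OF ff]) auto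
      also have "\<dots> = nabla L (u x) \<inter> nabla L (u y)"
        using u[OF x] u[OF y] frm.B_meet[of "f x" "f y"] frm.family_nabla[of "u x"]
          frm.family_nabla[of "u y"] by simp
      also have "\<dots> = nabla L (u x \<sqinter> u y)" using u[OF x] u[OF y] by (intro nabla_inter) auto
      finally show "f (x \<sqinter>\<^bsub>N\<^esub> y) = nabla L (u x \<sqinter> u y)" .
    qed
  qed (rule N)+
  define g where "g = first_part_hom.lift L N u"
  note g_hom = first_part_hom.lift_biframe_hom[OF lift, folded g_def]
  note g_part1 = first_part_hom.lift_part1[OF lift, folded g_def]
  note g_part2 = first_part_hom.lift_part2[OF lift, folded g_def]
  have hg: "frame_hom N FC (\<lambda>x. ?h (g x))"
    by (rule frame_hom_comp[OF _ frame_congruence_generated_hom])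
      (use g_hom in \<open>simp add: biframe_hom_def\<close>)
  have fc: "f x \<in> {\<theta>. frame_congruence L \<theta>}" if "x \<in> carrier N" for x
    using frame_homD(3)[OF ff that] frm.B_order by simp
  have le: "f x \<subseteq> f y" if "x \<in> carrier N" "y \<in> carrier N" "z \<in> carrier N"
      "x \<sqinter>\<^bsub>N\<^esub> z = \<bottom>\<^bsub>N\<^esub>" "y \<squnion>\<^bsub>N\<^esub> z = \<top>\<^bsub>N\<^esub>" for x y z
  proof -
    have "x = x \<sqinter>\<^bsub>N\<^esub> y" using N.cover_le[OF that] that N.meet_absorb1 by simp
    then have "f x = f x \<inter> f y"
      using frame_homD(5)[OF ff that(1,2)] frm.B_meet[OF fc fc] that by simp
    then show ?thesis by blast
  qed
  have eq1: "?h (g x) = f x" if x: "x \<in> part1 N" for x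
  proof -
    let ?W = "{w \<in> part1 N. rather_below N (part2 N) w x}"
    have xc: "x \<in> carrier N" using x p1(1) by blast
    have W: "(\<Union>a\<in>u ` ?W. nabla L a) = (\<Union>w\<in>?W. f w)" using u by auto
    have "?h (g x) = ?h (\<Union>a\<in>u ` ?W. nabla L a)"
      unfolding g_part1[OF x] by (rule frame_generated_lattice_generated) (auto simp: nabla_def)
    also have "\<dots> = f x"
      unfolding W
    proof
      show "?h (\<Union>w\<in>?W. f w) \<subseteq> f x"
      proof (rule frm.gen_least[OF fc[OF xc]], rule UN_least)
        fix w assume "w \<in> ?W"
        then obtain z where "w \<in> part1 N" "z \<in> part2 N" "w \<sqinter>\<^bsub>N\<^esub> z = \<bottom>\<^bsub>N\<^esub>" "x \<squnion>\<^bsub>N\<^esub> z = \<top>\<^bsub>N\<^esub>"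
          unfolding rather_below_def by blast
        then show "f w \<subseteq> f x" using le[of w x z] xc p1(1) p2(1) by blast
      qed
      obtain A where A: "A \<subseteq> ?W" "x = \<Squnion>\<^bsub>N\<^esub>A" using N(2) x unfolding regular_biframe_def by blast
      have Ac: "A \<subseteq> carrier N" using A p1(1) by auto
      have "f ` A \<subseteq> {\<theta>. frame_congruence L \<theta>}" using fc Ac by blast
      then have "f x = ?h (\<Union>(f ` A))"
        using frame_homD(6)[OF ff Ac] A(2) frm.B_sup[of "f ` A"] by simp
      also have "\<dots> \<subseteq> ?h (\<Union>w\<in>?W. f w)"
        using A(1) unfolding frame_congruence_generated_def by blast
      finally show "f x \<subseteq> ?h (\<Union>w\<in>?W. f w)" .
    qed
    finally show ?thesis .
  qed
  have eq2: "?h (g y) = f y" if y: "y \<in> part2 N" for y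
  proof -
    let ?T = "{t \<in> part1 N. t \<squnion>\<^bsub>N\<^esub> y = \<top>\<^bsub>N\<^esub>}"
    have yc: "y \<in> carrier N" using y p2(1) by blast
    have "?h (g y) = ?h (\<Union>a\<in>u ` ?T. delta L a)"
      unfolding g_part2[OF y] by (rule frame_generated_lattice_generated) (auto simp: delta_def)
    also have "\<dots> = f y"
    proof
      show "?h (\<Union>a\<in>u ` ?T. delta L a) \<subseteq> f y"
      proof (rule frm.gen_least[OF fc[OF yc]], rule UN_least)
        fix a assume "a \<in> u ` ?T"
        then obtain t where t: "t \<in> part1 N" "t \<squnion>\<^bsub>N\<^esub> y = \<top>\<^bsub>N\<^esub>" "a = u t" by blast
        have tc: "t \<in> carrier N" using t p1(1) by blast
        have ut: "u t \<in> carrier L" "f t = nabla L (u t)" using u[OF t(1)] by auto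
        have d: "delta L (u t) \<in> {\<theta>. frame_congruence L \<theta>}" using frm.family_delta[OF ut(1)] .
        have car: "delta L (u t) \<in> carrier FC" "f y \<in> carrier FC" "f t \<in> carrier FC"
          using d frm.B_order frame_homD(3)[OF ff] yc tc by auto
        have "delta L (u t) \<sqsubseteq>\<^bsub>FC\<^esub> f y"
        proof (rule M.cover_le[OF car])
          show "delta L (u t) \<sqinter>\<^bsub>FC\<^esub> f t = \<bottom>\<^bsub>FC\<^esub>"
            using frm.B_meet[OF d fc[OF tc]] ut nabla_inter_delta[OF ut(1)]
            by (simp add: frm.B_bottom Int_commute)
          show "f y \<squnion>\<^bsub>FC\<^esub> f t = \<top>\<^bsub>FC\<^esub>"
            using frame_hom_join[OF ff yc tc] t(2) frame_homD(4)[OF ff] join_comm[of N y t] by simp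
        qed
        then show "delta L a \<subseteq> f y" using t(3) frm.B_order by simp
      qed
      obtain A where A: "A \<subseteq> {x \<in> part2 N. rather_below N (part1 N) x y}" "y = \<Squnion>\<^bsub>N\<^esub>A"
        using N(2) y unfolding regular_biframe_def by blast
      have Ac: "A \<subseteq> carrier N" using A p2(1) by auto
      have fA: "f ` A \<subseteq> {\<theta>. frame_congruence L \<theta>}" using fc Ac by blast
      have gT: "?h (\<Union>a\<in>u ` ?T. delta L a) \<in> {\<theta>. frame_congruence L \<theta>}"
        by (rule frm.gen_in) (auto simp: delta_def)
      have "f x \<subseteq> ?h (\<Union>a\<in>u ` ?T. delta L a)" if xA: "x \<in> A" for x
      proof -
        obtain t where t: "t \<in> part1 N" "x \<sqinter>\<^bsub>N\<^esub> t = \<bottom>\<^bsub>N\<^esub>" "y \<squnion>\<^bsub>N\<^esub> t = \<top>\<^bsub>N\<^esub>"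
          using A(1) xA unfolding rather_below_def by blast
        have tc: "t \<in> carrier N" "x \<in> carrier N" using t p1(1) xA Ac by auto
        have ut: "u t \<in> carrier L" "f t = nabla L (u t)" using u[OF t(1)] by auto
        have d: "delta L (u t) \<in> {\<theta>. frame_congruence L \<theta>}" using frm.family_delta[OF ut(1)] .
        have car: "f x \<in> carrier FC" "delta L (u t) \<in> carrier FC" "f t \<in> carrier FC"
          using d frm.B_order frame_homD(3)[OF ff] tc by auto
        have "f x \<sqsubseteq>\<^bsub>FC\<^esub> delta L (u t)"
        proof (rule M.cover_le[OF car])
          show "f x \<sqinter>\<^bsub>FC\<^esub> f t = \<bottom>\<^bsub>FC\<^esub>"
            using frame_homD(5)[OF ff tc(2,1)] t(2) frame_hom_bottom[OF ff] by simp
          show "delta L (u t) \<squnion>\<^bsub>FC\<^esub> f t = \<top>\<^bsub>FC\<^esub>"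
            using frm.B_join[OF d fc[OF tc(1)]] ut frm.nabla_join_delta[OF ut(1)]
            by (simp add: frm.B_top Un_commute)
        qed
        then have "f x \<subseteq> delta L (u t)" using frm.B_order by simp
        moreover have "t \<in> ?T" using t join_comm[of N y t] by simp
        ultimately show ?thesis
          using frm.gen_upper[of "\<Union>a\<in>u ` ?T. delta L a"] by blast
      qed
      then have "?h (\<Union>(f ` A)) \<subseteq> ?h (\<Union>a\<in>u ` ?T. delta L a)"
        by (intro frm.gen_least[OF gT] UN_least)
      then show "f y \<subseteq> ?h (\<Union>a\<in>u ` ?T. delta L a)"
        using frame_homD(6)[OF ff Ac] A(2) frm.B_sup[OF fA] by simp
    qed
    finally show ?thesis .
  qed
  have "?h (g x) = f x" if "x \<in> carrier N" for x
    by (rule frame_hom_eq_on_biframe[OF bN hg ff _ that]) (use eq1 eq2 in blast)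
  then show ?thesis using g_hom by blast
qed

end

theorem mainTheorem17:
  fixes L :: "'a gorder"
  assumes "frame L"
  shows "universal_biframe_compactification TYPE('c)
           (lattice_congruence_biframe L) (frame_congruence_biframe L)
           (\<lambda>C. frame_congruence_generated L C)"
proof -
  interpret frame L by (rule assms)
  show ?thesis
    unfolding universal_biframe_compactification_def lattice_congruence_biframe_eq
      frame_congruence_biframe_eq
  proof (intro conjI allI impI frame_congruence_generated_compactification)
    fix N :: "'c biframe" and f
    assume "compact_biframe N \<and> regular_biframe N \<and> biframe_hom N FC f"
    then have N: "compact_biframe N" "regular_biframe N" and f: "biframe_hom N FC f" by auto
    obtain g where g: "biframe_hom N LC g"
      "\<And>x. x \<in> carrier N \<Longrightarrow> frame_congruence_generated L (g x) = f x"
      using factorization[OF N f] by blast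
    show "\<exists>!g. g \<in> extensional (carrier N) \<and> biframe_hom N LC g \<and>
        (\<forall>x\<in>carrier N. frame_congruence_generated L (g x) = f x)"
    proof (rule ex1I[of _ "restrict g (carrier N)"], intro conjI ballI restrict_extensional)
      show "biframe_hom N LC (restrict g (carrier N))"
        by (rule biframe_hom_cong[OF g(1)]) simp
      show "frame_congruence_generated L (restrict g (carrier N) x) = f x" if "x \<in> carrier N" for x
        using g(2) that by simp
      fix g' assume g': "g' \<in> extensional (carrier N) \<and> biframe_hom N LC g' \<and>
        (\<forall>x\<in>carrier N. frame_congruence_generated L (g' x) = f x)"
      have "g' x = g x" if "x \<in> carrier N" for x
        by (rule dense_biframe_hom_cancel[OF frame_congruence_generated_dense N(2) _ g(1) _ that])
          (use g' g(2) in auto)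
      then show "g' = restrict g (carrier N)"
        using g' by (intro extensionalityI[of _ "carrier N"]) auto
    qed
  qed
qed

end
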